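(* Let $\Gamma$ be a finite simplicial graph and $\mathcal{G}$ a collection of finitely generated groups indexed by $V(\Gamma)$. If the groups in $\mathcal{G}$ are coarse median, then so is the graph product $\Gamma \mathcal{G}$.
   Context: Given a simplicial graph $\Gamma$ and a collection of groups $\mathcal{G}=\{G_u\mid u\in V(\Gamma)\}$, the graph product $\Gamma\mathcal{G}$ is the quotient of the free product of the $G_u$ by the normal closure of all commutators $[g,h]$ with $g\in G_u$, $h\in G_v$, $\{u,v\}\in E(\Gamma)$. The vertex-groups $G_u$ are always assumed non-trivial. Let $X$ be a metric space; write $x\sim_\kappa y$ for $d(x,y)\le\kappa$. A ternary operation $\mu:X^3\to X$ is a coarse median if there exists $\kappa\ge0$ such that: (C0) for all $a_1,a_2,a_3\in X$ and every permutation $\sigma$ of $\{1,2,3\}$, $\mu(a_1,a_1,a_2)\sim_\kappa a_1$ and $\mu(a_{\sigma(1)},a_{\sigma(2)},a_{\sigma(3)})\sim_\kappa\mu(a_1,a_2,a_3)$; (C1) for all $a,a',b,c\in X$, $d(\mu(a,b,c),\mu(a',b,c))\le\kappa d(a,a')+\kappa$; (C2) for all $a,b,c,d\in X$, $\mu(\mu(a,b,c),b,d)\sim_\kappa\mu(a,b,\mu(c,b,d))$. A finitely generated group is coarse median if it admits a coarse median operation when endowed with the word metric associated with some (equivalently, any) finite generating set. *)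

theory Defs
  imports
    "HOL-Algebra.Coset"
    "HOL-Algebra.Generated_Groups"
    "HOL-Combinatorics.Permutations"
    "Graph_Theory.Pair_Digraph"
begin

section \<open>Free products\<close>

text \<open>
  The free product of the family \<open>(G u)\<close>, \<open>u \<in> V\<close>, is realised as the set of words whose
  letters are pairs \<open>(u, g)\<close> with \<open>g\<close> in \<open>G u\<close>, modulo the congruence that deletes identity
  letters and multiplies adjacent letters of the same index.
\<close>

definition fp_words :: "'v set \<Rightarrow> ('v \<Rightarrow> ('g, 'm) monoid_scheme) \<Rightarrow> ('v \<times> 'g) list set"
  where "fp_words V G = lists (SIGMA u : V. carrier (G u))"

inductive_set fp_rel ::
  "'v set \<Rightarrow> ('v \<Rightarrow> ('g, 'm) monoid_scheme) \<Rightarrow> (('v \<times> 'g) list \<times> ('v \<times> 'g) list) set"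
  for V :: "'v set" and G :: "'v \<Rightarrow> ('g, 'm) monoid_scheme"
where
  refl: "w \<in> fp_words V G \<Longrightarrow> (w, w) \<in> fp_rel V G"
| sym: "(w, w') \<in> fp_rel V G \<Longrightarrow> (w', w) \<in> fp_rel V G"
| trans: "(w, w') \<in> fp_rel V G \<Longrightarrow> (w', w'') \<in> fp_rel V G \<Longrightarrow> (w, w'') \<in> fp_rel V G"
| one: "x \<in> fp_words V G \<Longrightarrow> y \<in> fp_words V G \<Longrightarrow> u \<in> V
    \<Longrightarrow> (x @ [(u, \<one>\<^bsub>G u\<^esub>)] @ y, x @ y) \<in> fp_rel V G"
| mult: "x \<in> fp_words V G \<Longrightarrow> y \<in> fp_words V G \<Longrightarrow> u \<in> V
    \<Longrightarrow> g \<in> carrier (G u) \<Longrightarrow> h \<in> carrier (G u)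
    \<Longrightarrow> (x @ [(u, g), (u, h)] @ y, x @ [(u, g \<otimes>\<^bsub>G u\<^esub> h)] @ y) \<in> fp_rel V G"

definition free_product ::
  "'v set \<Rightarrow> ('v \<Rightarrow> ('g, 'm) monoid_scheme) \<Rightarrow> ('v \<times> 'g) list set monoid"
  where "free_product V G =
    \<lparr>carrier = fp_words V G // fp_rel V G,
     monoid.mult = (\<lambda>X Y. \<Union>x\<in>X. \<Union>y\<in>Y. fp_rel V G `` {x @ y}),
     one = fp_rel V G `` {[]}\<rparr>"

definition fp_incl ::
  "'v set \<Rightarrow> ('v \<Rightarrow> ('g, 'm) monoid_scheme) \<Rightarrow> 'v \<Rightarrow> 'g \<Rightarrow> ('v \<times> 'g) list set"
  where "fp_incl V G u g = fp_rel V G `` {[(u, g)]}"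


section \<open>Graph products\<close>

definition normal_closure :: "('a, 'm) monoid_scheme \<Rightarrow> 'a set \<Rightarrow> 'a set"
  where "normal_closure G S = \<Inter> {N. N \<lhd> G \<and> S \<subseteq> N}"

definition group_commutator :: "('a, 'm) monoid_scheme \<Rightarrow> 'a \<Rightarrow> 'a \<Rightarrow> 'a"
  where "group_commutator G g h = g \<otimes>\<^bsub>G\<^esub> h \<otimes>\<^bsub>G\<^esub> inv\<^bsub>G\<^esub> g \<otimes>\<^bsub>G\<^esub> inv\<^bsub>G\<^esub> h"

definition graph_product_relators ::
  "'v pair_pre_digraph \<Rightarrow> ('v \<Rightarrow> ('g, 'm) monoid_scheme) \<Rightarrow> ('v \<times> 'g) list set set"
  where "graph_product_relators \<Gamma> G =
    {group_commutator (free_product (pverts \<Gamma>) G)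
       (fp_incl (pverts \<Gamma>) G u g) (fp_incl (pverts \<Gamma>) G v h) | u v g h.
       (u, v) \<in> parcs \<Gamma> \<and> g \<in> carrier (G u) \<and> h \<in> carrier (G v)}"

definition graph_product ::
  "'v pair_pre_digraph \<Rightarrow> ('v \<Rightarrow> ('g, 'm) monoid_scheme) \<Rightarrow> ('v \<times> 'g) list set set monoid"
  where "graph_product \<Gamma> G =
    free_product (pverts \<Gamma>) G Mod
      normal_closure (free_product (pverts \<Gamma>) G) (graph_product_relators \<Gamma> G)"


section \<open>Finite generation and word metrics\<close>

definition finite_generating_set :: "('a, 'm) monoid_scheme \<Rightarrow> 'a set \<Rightarrow> bool"
  where "finite_generating_set G S \<longleftrightarrow>
    finite S \<and> S \<subseteq> carrier G \<and> generate G S = carrier G"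

definition finitely_generated_group :: "('a, 'm) monoid_scheme \<Rightarrow> bool"
  where "finitely_generated_group G \<longleftrightarrow> group G \<and> (\<exists>S. finite_generating_set G S)"

definition word_length :: "('a, 'm) monoid_scheme \<Rightarrow> 'a set \<Rightarrow> 'a \<Rightarrow> nat"
  where "word_length G S g =
    (LEAST n. \<exists>ws. length ws = n \<and> set ws \<subseteq> S \<union> m_inv G ` S \<and>
                   foldr (\<otimes>\<^bsub>G\<^esub>) ws \<one>\<^bsub>G\<^esub> = g)"

text \<open>Only meaningful for elements of the carrier and when \<open>S\<close> generates \<open>G\<close>.\<close>

definition word_dist :: "('a, 'm) monoid_scheme \<Rightarrow> 'a set \<Rightarrow> 'a \<Rightarrow> 'a \<Rightarrow> real"
  where "word_dist G S g h = real (word_length G S (inv\<^bsub>G\<^esub> g \<otimes>\<^bsub>G\<^esub> h))"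


section \<open>Coarse medians\<close>

definition coarse_median ::
  "'a set \<Rightarrow> ('a \<Rightarrow> 'a \<Rightarrow> real) \<Rightarrow> ('a \<Rightarrow> 'a \<Rightarrow> 'a \<Rightarrow> 'a) \<Rightarrow> bool"
  where "coarse_median X d \<mu> \<longleftrightarrow>
    (\<forall>a\<in>X. \<forall>b\<in>X. \<forall>c\<in>X. \<mu> a b c \<in> X) \<and>
    (\<exists>\<kappa>\<ge>0.
      (\<forall>a :: nat \<Rightarrow> 'a. (\<forall>i\<in>{1,2,3}. a i \<in> X) \<longrightarrow>
         (\<forall>\<sigma>. \<sigma> permutes {1,2,3} \<longrightarrow>
            d (\<mu> (a 1) (a 1) (a 2)) (a 1) \<le> \<kappa> \<and>
            d (\<mu> (a (\<sigma> 1)) (a (\<sigma> 2)) (a (\<sigma> 3))) (\<mu> (a 1) (a 2) (a 3)) \<le> \<kappa>)) \<and>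
      (\<forall>a\<in>X. \<forall>a'\<in>X. \<forall>b\<in>X. \<forall>c\<in>X.
         d (\<mu> a b c) (\<mu> a' b c) \<le> \<kappa> * d a a' + \<kappa>) \<and>
      (\<forall>a\<in>X. \<forall>b\<in>X. \<forall>c\<in>X. \<forall>e\<in>X.
         d (\<mu> (\<mu> a b c) b e) (\<mu> a b (\<mu> c b e)) \<le> \<kappa>))"

text \<open>
  Changing the finite generating set changes the word metric by a bi-Lipschitz equivalence, so
  the existential quantifier over generating sets could equivalently be a universal one.
\<close>

definition coarse_median_group :: "('a, 'm) monoid_scheme \<Rightarrow> bool"
  where "coarse_median_group G \<longleftrightarrow> finitely_generated_group G \<and>
    (\<exists>S. finite_generating_set G S \<and> (\<exists>\<mu>. coarse_median (carrier G) (word_dist G S) \<mu>))"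


section \<open>The constructions yield groups\<close>

lemma fp_words_append [simp]:
  "x @ y \<in> fp_words V G \<longleftrightarrow> x \<in> fp_words V G \<and> y \<in> fp_words V G"
  by (auto simp: fp_words_def)

lemma fp_words_Nil [simp]: "[] \<in> fp_words V G"
  by (simp add: fp_words_def)

lemma fp_words_Cons [simp]:
  "(u, g) # w \<in> fp_words V G \<longleftrightarrow> u \<in> V \<and> g \<in> carrier (G u) \<and> w \<in> fp_words V G"
  by (auto simp: fp_words_def)

lemma fp_rel_words:
  assumes "\<And>u. u \<in> V \<Longrightarrow> group (G u)" and "(w, w') \<in> fp_rel V G"
  shows "w \<in> fp_words V G \<and> w' \<in> fp_words V G"
  using assms(2)
proof induction
  case (one x y u)
  interpret group "G u" using one assms(1) by blast
  show ?case using one by simp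
next
  case (mult x y u g h)
  interpret group "G u" using mult assms(1) by blast
  show ?case using mult by simp
qed auto

lemma fp_rel_equiv:
  assumes "\<And>u. u \<in> V \<Longrightarrow> group (G u)"
  shows "equiv (fp_words V G) (fp_rel V G)"
proof (rule equivI)
  show "fp_rel V G \<subseteq> fp_words V G \<times> fp_words V G"
    using fp_rel_words[where V = V and G = G] assms by fast
  show "refl_on (fp_words V G) (fp_rel V G)"
    by (simp add: refl_on_def fp_rel.refl)
  show "sym (fp_rel V G)"
    by (rule symI) (erule fp_rel.sym)
  show "trans (fp_rel V G)"
    by (rule transI) (erule (1) fp_rel.trans)
qed

lemma fp_rel_context:
  assumes "(w, w') \<in> fp_rel V G" "p \<in> fp_words V G" "q \<in> fp_words V G"
  shows "(p @ w @ q, p @ w' @ q) \<in> fp_rel V G"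
  using assms
proof induction
  case (refl w)
  then show ?case by (simp add: fp_rel.refl)
next
  case (sym w w')
  then show ?case by (simp add: fp_rel.sym)
next
  case (trans w w' w'')
  then show ?case by (intro fp_rel.trans[OF trans.IH])
next
  case (one x y u)
  then show ?case using fp_rel.one[of "p @ x" V G "y @ q" u] by simp
next
  case (mult x y u g h)
  then show ?case using fp_rel.mult[of "p @ x" V G "y @ q" u g h] by simp
qed

lemma fp_rel_append:
  assumes G: "\<And>u. u \<in> V \<Longrightarrow> group (G u)"
    and "(x, x') \<in> fp_rel V G" "(y, y') \<in> fp_rel V G"
  shows "(x @ y, x' @ y') \<in> fp_rel V G"
proof -
  have "(x @ y, x' @ y) \<in> fp_rel V G"
    using fp_rel_context[OF assms(2), of "[]" y] fp_rel_words[OF G assms(3)] by simp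
  moreover have "(x' @ y, x' @ y') \<in> fp_rel V G"
    using fp_rel_context[OF assms(3), of x' "[]"] fp_rel_words[OF G assms(2)] by simp
  ultimately show ?thesis by (rule fp_rel.trans)
qed

lemma free_product_mult_class:
  assumes G: "\<And>u. u \<in> V \<Longrightarrow> group (G u)"
    and "x \<in> fp_words V G" "y \<in> fp_words V G"
  shows "fp_rel V G `` {x} \<otimes>\<^bsub>free_product V G\<^esub> fp_rel V G `` {y} = fp_rel V G `` {x @ y}"
proof -
  have *: "fp_rel V G `` {x' @ y'} = fp_rel V G `` {x @ y}"
    if "x' \<in> fp_rel V G `` {x}" "y' \<in> fp_rel V G `` {y}" for x' y'
  proof -
    have "(x @ y, x' @ y') \<in> fp_rel V G"
      using that by (intro fp_rel_append[OF G]) simp_all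
    from equiv_class_eq[OF fp_rel_equiv[OF G] this] show ?thesis by simp
  qed
  have ne: "fp_rel V G `` {x} \<noteq> {}" "fp_rel V G `` {y} \<noteq> {}"
    using fp_rel.refl[OF assms(2)] fp_rel.refl[OF assms(3)] by blast+
  have "(\<Union>x'\<in>fp_rel V G `` {x}. \<Union>y'\<in>fp_rel V G `` {y}. fp_rel V G `` {x' @ y'})
      = (\<Union>x'\<in>fp_rel V G `` {x}. \<Union>y'\<in>fp_rel V G `` {y}. fp_rel V G `` {x @ y})"
    by (intro SUP_cong HOL.refl *)
  also have "\<dots> = fp_rel V G `` {x @ y}"
    using ne by (simp only: UN_constant if_False)
  finally show ?thesis
    unfolding free_product_def by simp
qed

lemma free_product_carrierI:
  "x \<in> fp_words V G \<Longrightarrow> fp_rel V G `` {x} \<in> carrier (free_product V G)"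
  by (simp add: free_product_def quotientI)

lemma free_product_carrierE:
  assumes "X \<in> carrier (free_product V G)"
  obtains x where "x \<in> fp_words V G" "X = fp_rel V G `` {x}"
  using assms by (auto simp: free_product_def elim: quotientE)

lemma fp_left_inverse:
  assumes G: "\<And>u. u \<in> V \<Longrightarrow> group (G u)" and "x \<in> fp_words V G"
  shows "\<exists>y\<in>fp_words V G. (y @ x, []) \<in> fp_rel V G"
  using assms(2)
proof (induction x)
  case Nil
  show ?case by (rule bexI[of _ "[]"]) (auto intro: fp_rel.refl)
next
  case (Cons a x)
  obtain u g where a: "a = (u, g)" by fastforce
  have u: "u \<in> V" "g \<in> carrier (G u)" and x: "x \<in> fp_words V G"
    using Cons.prems a by auto
  interpret group "G u" using G u by blast
  obtain y where y: "y \<in> fp_words V G" "(y @ x, []) \<in> fp_rel V G"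
    using Cons.IH x by blast
  let ?i = "inv\<^bsub>G u\<^esub> g"
  have "(y @ [(u, ?i), (u, g)] @ x, y @ [(u, ?i \<otimes>\<^bsub>G u\<^esub> g)] @ x) \<in> fp_rel V G"
    using fp_rel.mult[OF y(1) x u(1), of ?i g] u by simp
  moreover have "(y @ [(u, ?i \<otimes>\<^bsub>G u\<^esub> g)] @ x, y @ x) \<in> fp_rel V G"
    using fp_rel.one[OF y(1) x u(1)] u by simp
  ultimately have "(y @ [(u, ?i), (u, g)] @ x, []) \<in> fp_rel V G"
    using y(2) fp_rel.trans by metis
  then have "((y @ [(u, ?i)]) @ a # x, []) \<in> fp_rel V G"
    by (simp add: a)
  moreover have "y @ [(u, ?i)] \<in> fp_words V G"
    using y u by simp
  ultimately show ?case by blast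
qed

lemma free_product_group:
  assumes G: "\<And>u. u \<in> V \<Longrightarrow> group (G u)"
  shows "group (free_product V G)"
proof (rule groupI)
  have one: "\<one>\<^bsub>free_product V G\<^esub> = fp_rel V G `` {[]}"
    by (simp add: free_product_def)
  note cls = free_product_mult_class[OF G]
  show "\<one>\<^bsub>free_product V G\<^esub> \<in> carrier (free_product V G)"
    by (simp add: one free_product_carrierI)
  fix X assume "X \<in> carrier (free_product V G)"
  then obtain x where x: "x \<in> fp_words V G" "X = fp_rel V G `` {x}"
    by (rule free_product_carrierE)
  show "\<one>\<^bsub>free_product V G\<^esub> \<otimes>\<^bsub>free_product V G\<^esub> X = X"
    by (simp add: one x cls)
  obtain y where y: "y \<in> fp_words V G" "(y @ x, []) \<in> fp_rel V G"
    using fp_left_inverse[OF G x(1)] by blast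
  then have "fp_rel V G `` {y} \<otimes>\<^bsub>free_product V G\<^esub> X = \<one>\<^bsub>free_product V G\<^esub>"
    using x by (simp add: one cls equiv_class_eq[OF fp_rel_equiv[OF G]])
  then show "\<exists>Y\<in>carrier (free_product V G).
      Y \<otimes>\<^bsub>free_product V G\<^esub> X = \<one>\<^bsub>free_product V G\<^esub>"
    using y(1) free_product_carrierI by blast
  fix Y assume "Y \<in> carrier (free_product V G)"
  then obtain y where y: "y \<in> fp_words V G" "Y = fp_rel V G `` {y}"
    by (rule free_product_carrierE)
  show "X \<otimes>\<^bsub>free_product V G\<^esub> Y \<in> carrier (free_product V G)"
    using x y by (simp add: cls free_product_carrierI)
  fix Z assume "Z \<in> carrier (free_product V G)"
  then obtain z where z: "z \<in> fp_words V G" "Z = fp_rel V G `` {z}"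
    by (rule free_product_carrierE)
  show "X \<otimes>\<^bsub>free_product V G\<^esub> Y \<otimes>\<^bsub>free_product V G\<^esub> Z =
      X \<otimes>\<^bsub>free_product V G\<^esub> (Y \<otimes>\<^bsub>free_product V G\<^esub> Z)"
    using x y z by (simp add: cls)
qed

lemma normal_closure_normal:
  assumes "group G" "S \<subseteq> carrier G"
  shows "normal_closure G S \<lhd> G"
proof -
  interpret group G by fact
  have c: "carrier G \<lhd> G"
    by (simp add: normal_inv_iff subgroup_self)
  have "subgroup (\<Inter> {N. N \<lhd> G \<and> S \<subseteq> N}) G"
    using c assms(2) by (intro subgroups_Inter) (auto dest: normal_imp_subgroup)
  then show ?thesis
    unfolding normal_closure_def by (auto simp: normal_inv_iff)
qed

lemma graph_product_group:
  assumes "pair_graph \<Gamma>" and G: "\<And>u. u \<in> pverts \<Gamma> \<Longrightarrow> group (G u)"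
  shows "group (graph_product \<Gamma> G)"
proof -
  interpret pair_graph \<Gamma> by fact
  interpret F: group "free_product (pverts \<Gamma>) G"
    by (rule free_product_group[OF G])
  have "graph_product_relators \<Gamma> G \<subseteq> carrier (free_product (pverts \<Gamma>) G)"
    by (auto simp: graph_product_relators_def group_commutator_def fp_incl_def
        intro!: F.m_closed F.inv_closed free_product_carrierI
        dest: arc_fst_in_verts arc_snd_in_verts)
  then show ?thesis
    unfolding graph_product_def
    by (intro normal.factorgroup_is_group normal_closure_normal F.is_group)
qed

end

theory Submission
  imports Defs
begin

text \<open>
  Write \<open>p\<^sub>u(x)\<close> for the syllable of \<open>x\<close> in the vertex group \<open>G\<^sub>u\<close> that can be shuffled to the
  front.  The functions \<open>x \<mapsto> p\<^sub>u(g\<inverse>x)\<close> are coordinates on the graph product, one for each hyperplane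
  of its quasi-median Cayley graph, and the word metric is the sum of the word metrics of the
  coordinates.  Two hyperplanes that are not transverse constrain the coordinates to a cross: one of
  two coordinates has a fixed value.  If the medians of the vertex groups are first changed by a
  bounded amount so that \<open>\<mu>(a,a,b) = \<mu>(a,b,a) = \<mu>(b,a,a) = a\<close>, then the coordinatewise median of three
  points respects all these crosses, and hence is realised by a point.  The axioms hold exactly in
  every coordinate where at most two values are involved.  Again by the crosses, the hyperplanes with
  three distinct values for a given triple have pairwise distinct labels, so that only boundedly many
  coordinates contribute an error.
\<close>

section \<open>Word metrics\<close>

text \<open>The obstacle is accumulation: two points may differ in unboundedly many coordinates, so
  an axiom violated by \<open>\<kappa>\<close> in each of them would be violated without bound. On
  at most two values an exact majority turns (C0) and (C2) into Boolean identities, which confines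
  the errors to the coordinates with three values. Condition (C1) is treated differently: it is
  checked along one generator, which moves a single coordinate by at most 1. Realisation is an
  extremal argument. Start at one of the three points and move as far from it as possible while each
  coordinate is either unchanged or already at its target. At such a point the hyperplanes adjacent
  to it have reached the target, and the crosses propagate this to all others. Coordinates
  presuppose that front syllables are well defined on a quotient of the free product, which is the
  normal form theorem for graph products. It is obtained by van der Waerden's trick: the free
  product acts on reduced words up to shuffling, and the relators act trivially. The geometry then
  rests only on the properties of front syllables collected in
  \<open>head_projections\<close>.\<close>

locale word_metric = group G for G (structure) +
  fixes S
  assumes gens_sub: "S \<subseteq> carrier G"
    and gens_generate: "generate G S = carrier G"
begin

abbreviation letters where "letters \<equiv> S \<union> m_inv G ` S"

lemma letters_sub: "letters \<subseteq> carrier G"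
  using gens_sub by auto

lemma foldr_mult_closed: "set ws \<subseteq> carrier G \<Longrightarrow> foldr (\<otimes>) ws \<one> \<in> carrier G"
  by (induction ws) auto

lemma foldr_mult_append:
  "set ws \<subseteq> carrier G \<Longrightarrow> set vs \<subseteq> carrier G \<Longrightarrow>
    foldr (\<otimes>) (ws @ vs) \<one> = foldr (\<otimes>) ws \<one> \<otimes> foldr (\<otimes>) vs \<one>"
  by (induction ws) (auto simp: m_assoc foldr_mult_closed)

lemma foldr_mult_inv:
  "set ws \<subseteq> letters \<Longrightarrow> \<exists>vs. set vs \<subseteq> letters \<and> length vs = length ws \<and>
    foldr (\<otimes>) vs \<one> = inv (foldr (\<otimes>) ws \<one>)"
proof (induction ws)
  case (Cons s ws)
  then obtain vs where vs: "set vs \<subseteq> letters" "length vs = length ws"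
    "foldr (\<otimes>) vs \<one> = inv (foldr (\<otimes>) ws \<one>)" by auto
  have s: "inv s \<in> letters" "s \<in> carrier G"
    using Cons.prems gens_sub by auto
  have "set vs \<subseteq> carrier G" "set ws \<subseteq> carrier G"
    using vs(1) Cons.prems letters_sub by auto
  then have "foldr (\<otimes>) (vs @ [inv s]) \<one> = inv (foldr (\<otimes>) (s # ws) \<one>)"
    using s vs(3) by (subst foldr_mult_append) (auto simp: foldr_mult_closed inv_mult_group)
  moreover have "set (vs @ [inv s]) \<subseteq> letters" "length (vs @ [inv s]) = length (s # ws)"
    using vs s by auto
  ultimately show ?case by blast
qed auto

lemma word_exists:
  assumes "x \<in> carrier G"
  shows "\<exists>ws. set ws \<subseteq> letters \<and> foldr (\<otimes>) ws \<one> = x"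
proof -
  have "x \<in> generate G S" using assms gens_generate by simp
  then show ?thesis
  proof induction
    case one show ?case by (rule exI[of _ "[]"]) simp
  next
    case (incl h) then show ?case using gens_sub by (intro exI[of _ "[h]"]) auto
  next
    case (inv h) then show ?case using gens_sub by (intro exI[of _ "[inv h]"]) auto
  next
    case (eng h1 h2)
    then obtain v w where *: "set v \<subseteq> letters" "foldr (\<otimes>) v \<one> = h1"
      "set w \<subseteq> letters" "foldr (\<otimes>) w \<one> = h2" by auto
    then show ?case using letters_sub
      by (intro exI[of _ "v @ w"]) (subst foldr_mult_append, auto)
  qed
qed

lemma word_length_attained:
  assumes "x \<in> carrier G"
  obtains ws where "length ws = word_length G S x" "set ws \<subseteq> letters" "foldr (\<otimes>) ws \<one> = x"
proof -
  let ?P = "\<lambda>n. \<exists>ws. length ws = n \<and> set ws \<subseteq> letters \<and> foldr (\<otimes>) ws \<one> = x"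
  have "\<exists>n. ?P n" using word_exists[OF assms] by blast
  then have "?P (word_length G S x)"
    unfolding word_length_def by (rule LeastI_ex)
  then show thesis using that by blast
qed

lemma word_length_le:
  "set ws \<subseteq> letters \<Longrightarrow> word_length G S (foldr (\<otimes>) ws \<one>) \<le> length ws"
  unfolding word_length_def by (rule Least_le) blast

lemma word_length_one: "word_length G S \<one> = 0"
  using word_length_le[of "[]"] by simp

lemma word_length_letter: "s \<in> letters \<Longrightarrow> word_length G S s \<le> 1"
  using word_length_le[of "[s]"] letters_sub by auto

lemma word_length_mult:
  assumes "x \<in> carrier G" "y \<in> carrier G"
  shows "word_length G S (x \<otimes> y) \<le> word_length G S x + word_length G S y"
proof -
  obtain v where v: "length v = word_length G S x" "set v \<subseteq> letters" "foldr (\<otimes>) v \<one> = x"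
    by (rule word_length_attained[OF assms(1)])
  obtain w where w: "length w = word_length G S y" "set w \<subseteq> letters" "foldr (\<otimes>) w \<one> = y"
    by (rule word_length_attained[OF assms(2)])
  have "foldr (\<otimes>) (v @ w) \<one> = x \<otimes> y"
    using v w letters_sub by (subst foldr_mult_append) auto
  then show ?thesis
    using word_length_le[of "v @ w"] v w by simp
qed

lemma word_length_inv:
  assumes "x \<in> carrier G"
  shows "word_length G S (inv x) = word_length G S x"
proof -
  have "word_length G S (inv y) \<le> word_length G S y" if y: "y \<in> carrier G" for y
  proof -
    obtain w where w: "length w = word_length G S y" "set w \<subseteq> letters" "foldr (\<otimes>) w \<one> = y"
      by (rule word_length_attained[OF y])
    then show ?thesis using foldr_mult_inv[OF w(2)] word_length_le by metis
  qed
  from this[of x] this[of "inv x"] show ?thesis using assms by simp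
qed

lemma word_dist_self: "x \<in> carrier G \<Longrightarrow> word_dist G S x x = 0"
  by (simp add: word_dist_def word_length_one)

lemma word_dist_nonneg: "0 \<le> word_dist G S x y"
  by (simp add: word_dist_def)

lemma word_dist_commute:
  assumes "x \<in> carrier G" "y \<in> carrier G"
  shows "word_dist G S x y = word_dist G S y x"
  using word_length_inv[of "inv x \<otimes> y"] assms by (simp add: word_dist_def inv_mult_group)

lemma word_dist_triangle:
  assumes "x \<in> carrier G" "y \<in> carrier G" "z \<in> carrier G"
  shows "word_dist G S x z \<le> word_dist G S x y + word_dist G S y z"
proof -
  have "inv x \<otimes> z = (inv x \<otimes> y) \<otimes> (inv y \<otimes> z)"
    using assms by (simp add: m_assoc) (simp add: m_assoc[symmetric])
  then show ?thesis
    using word_length_mult[of "inv x \<otimes> y" "inv y \<otimes> z"] assms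
    by (simp add: word_dist_def flip: of_nat_add)
qed

lemma word_dist_mult_right:
  "x \<in> carrier G \<Longrightarrow> y \<in> carrier G \<Longrightarrow> word_dist G S x (x \<otimes> y) = real (word_length G S y)"
  by (simp add: word_dist_def m_assoc[symmetric])

text \<open>A word for \<open>inv x \<otimes> y\<close> is a path from \<open>x\<close> to
  \<open>y\<close>, so a bound per letter adds up along it. This reduces (C1) to single
  generators.\<close>

lemma word_dist_lipschitz:
  assumes f: "\<And>x. x \<in> carrier G \<Longrightarrow> f x \<in> carrier G"
    and step: "\<And>x s. x \<in> carrier G \<Longrightarrow> s \<in> letters \<Longrightarrow> word_dist G S (f x) (f (x \<otimes> s)) \<le> L"
    and "x \<in> carrier G" "y \<in> carrier G"
  shows "word_dist G S (f x) (f y) \<le> L * word_dist G S x y"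
proof -
  have *: "word_dist G S (f x) (f (x \<otimes> foldr (\<otimes>) ws \<one>)) \<le> L * real (length ws)"
    if "x \<in> carrier G" "set ws \<subseteq> letters" for x ws
    using that
  proof (induction ws arbitrary: x)
    case (Cons s ws)
    let ?w = "foldr (\<otimes>) ws \<one>"
    have c: "s \<in> carrier G" "?w \<in> carrier G" "s \<in> letters"
      using Cons.prems letters_sub by (auto intro!: foldr_mult_closed)
    have "word_dist G S (f x) (f (x \<otimes> (s \<otimes> ?w))) \<le>
        word_dist G S (f x) (f (x \<otimes> s)) + word_dist G S (f (x \<otimes> s)) (f (x \<otimes> (s \<otimes> ?w)))"
      using Cons.prems c by (intro word_dist_triangle f) auto
    also have "\<dots> \<le> L + L * real (length ws)"
      using Cons.IH[of "x \<otimes> s"] Cons.prems c step[of x s] by (simp add: m_assoc)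
    finally show ?case by (simp add: algebra_simps)
  qed (simp add: f word_dist_self)
  obtain ws where ws: "length ws = word_length G S (inv x \<otimes> y)" "set ws \<subseteq> letters"
    "foldr (\<otimes>) ws \<one> = inv x \<otimes> y"
    using word_length_attained[of "inv x \<otimes> y"] assms by blast
  show ?thesis
    using *[OF assms(3) ws(2)] ws assms(3,4) by (simp add: word_dist_def m_assoc[symmetric])
qed

end

section \<open>Coarse medians that are exact on repeated arguments\<close>

definition majority :: "'a \<Rightarrow> 'a \<Rightarrow> 'a \<Rightarrow> ('a \<Rightarrow> 'a \<Rightarrow> 'a \<Rightarrow> 'a) \<Rightarrow> 'a"
  where "majority a b c \<mu> = (if a = b \<or> a = c then a else if b = c then b else \<mu> a b c)"

text \<open>The constant is a parameter so that finitely many vertex groups can share one. The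
  equations for repeated arguments are exact because they are applied in unboundedly many
  coordinates at once.\<close>

definition strict_coarse_median ::
  "'a set \<Rightarrow> ('a \<Rightarrow> 'a \<Rightarrow> real) \<Rightarrow> real \<Rightarrow> ('a \<Rightarrow> 'a \<Rightarrow> 'a \<Rightarrow> 'a) \<Rightarrow> bool"
  where "strict_coarse_median X d \<kappa> \<mu> \<longleftrightarrow> 0 \<le> \<kappa> \<and>
    (\<forall>a\<in>X. \<forall>b\<in>X. \<forall>c\<in>X. \<mu> a b c \<in> X) \<and>
    (\<forall>a b. \<mu> a a b = a \<and> \<mu> a b a = a \<and> \<mu> b a a = a) \<and>
    (\<forall>a :: nat \<Rightarrow> 'a. (\<forall>i\<in>{1,2,3}. a i \<in> X) \<longrightarrow> (\<forall>\<sigma>. \<sigma> permutes {1,2,3} \<longrightarrow>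
        d (\<mu> (a (\<sigma> 1)) (a (\<sigma> 2)) (a (\<sigma> 3))) (\<mu> (a 1) (a 2) (a 3)) \<le> \<kappa>)) \<and>
    (\<forall>a\<in>X. \<forall>a'\<in>X. \<forall>b\<in>X. \<forall>c\<in>X. d (\<mu> a b c) (\<mu> a' b c) \<le> \<kappa> * d a a' + \<kappa>) \<and>
    (\<forall>a\<in>X. \<forall>b\<in>X. \<forall>c\<in>X. \<forall>e\<in>X. d (\<mu> (\<mu> a b c) b e) (\<mu> a b (\<mu> c b e)) \<le> \<kappa>)"

lemma strict_coarse_median_mono:
  assumes "strict_coarse_median X d \<kappa> \<mu>" "\<kappa> \<le> \<kappa>'" "\<And>x y. 0 \<le> d x y"
  shows "strict_coarse_median X d \<kappa>' \<mu>"
proof -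
  have "\<kappa> * d x y + \<kappa> \<le> \<kappa>' * d x y + \<kappa>'" for x y
    using assms(2,3) by (intro add_mono mult_right_mono)
  then show ?thesis
    using assms unfolding strict_coarse_median_def by (meson order_trans)
qed

text \<open>By (C0), a repeated argument already determines \<open>\<mu>\<close> up to
  \<open>2 * \<kappa>\<close>. Overwriting these values by the majority therefore moves
  \<open>\<mu>\<close> a bounded distance, and every axiom survives with a larger constant.\<close>

lemma (in word_metric) coarse_median_rectify:
  assumes "coarse_median (carrier G) (word_dist G S) \<mu>"
  shows "\<exists>\<kappa> \<nu>. strict_coarse_median (carrier G) (word_dist G S) \<kappa> \<nu>"
proof -
  let ?X = "carrier G" and ?d = "word_dist G S"
  obtain \<kappa> where \<kappa>: "0 \<le> \<kappa>"
    and C0: "\<forall>a :: nat \<Rightarrow> 'a. (\<forall>i\<in>{1,2,3}. a i \<in> ?X) \<longrightarrow> (\<forall>\<sigma>. \<sigma> permutes {1,2,3} \<longrightarrow>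
      ?d (\<mu> (a 1) (a 1) (a 2)) (a 1) \<le> \<kappa> \<and>
      ?d (\<mu> (a (\<sigma> 1)) (a (\<sigma> 2)) (a (\<sigma> 3))) (\<mu> (a 1) (a 2) (a 3)) \<le> \<kappa>)"
    and C1: "\<forall>a\<in>?X. \<forall>a'\<in>?X. \<forall>b\<in>?X. \<forall>c\<in>?X.
      ?d (\<mu> a b c) (\<mu> a' b c) \<le> \<kappa> * ?d a a' + \<kappa>"
    and C2: "\<forall>a\<in>?X. \<forall>b\<in>?X. \<forall>c\<in>?X. \<forall>e\<in>?X.
      ?d (\<mu> (\<mu> a b c) b e) (\<mu> a b (\<mu> c b e)) \<le> \<kappa>"
    using assms unfolding coarse_median_def by (elim conjE exE) (rule that)
  note C0 = C0[THEN spec, THEN mp, THEN spec, THEN mp]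
    and C1 = C1[rule_format] and C2 = C2[rule_format]
  have cl: "\<mu> a b c \<in> ?X" if "a \<in> ?X" "b \<in> ?X" "c \<in> ?X" for a b c
    using assms that unfolding coarse_median_def by (elim conjE) blast
  define \<nu> where "\<nu> a b c = majority a b c \<mu>" for a b c
  have \<nu>cl: "\<nu> a b c \<in> ?X" if "a \<in> ?X" "b \<in> ?X" "c \<in> ?X" for a b c
    using that cl by (auto simp: \<nu>_def majority_def)
  have tri: "?d x z \<le> r + s" if "?d x y \<le> r" "?d y z \<le> s" "x \<in> ?X" "y \<in> ?X" "z \<in> ?X"
    for x y z r s
    using word_dist_triangle[of x y z] that by linarith
  have sw: "?d (\<mu> a c b) (\<mu> a b c) \<le> \<kappa>" "?d (\<mu> c b a) (\<mu> a b c) \<le> \<kappa>" "?d (\<mu> a a b) a \<le> \<kappa>"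
    if "a \<in> ?X" "b \<in> ?X" "c \<in> ?X" for a b c
  proof -
    let ?a = "\<lambda>i::nat. if i = 1 then a else if i = 2 then b else c"
    have t: "transpose 2 3 permutes {1,2,3::nat}" "transpose 1 3 permutes {1,2,3::nat}"
      by (auto intro: permutes_swap_id)
    have i: "\<forall>i\<in>{1,2,3}. ?a i \<in> ?X" using that by simp
    show "?d (\<mu> a c b) (\<mu> a b c) \<le> \<kappa>" "?d (\<mu> a a b) a \<le> \<kappa>"
      using C0[of ?a, OF i t(1)] by (simp_all add: transpose_def)
    show "?d (\<mu> c b a) (\<mu> a b c) \<le> \<kappa>"
      using C0[of ?a, OF i t(2)] by (simp add: transpose_def)
  qed
  have near: "?d (\<nu> a b c) (\<mu> a b c) \<le> 2 * \<kappa>" if "a \<in> ?X" "b \<in> ?X" "c \<in> ?X" for a b c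
  proof -
    have "?d (\<mu> a b c) (\<nu> a b c) \<le> 2 * \<kappa>"
    proof -
      consider "a = b" | "a \<noteq> b" "a = c" | "a \<noteq> b" "a \<noteq> c" "b = c"
        | "a \<noteq> b" "a \<noteq> c" "b \<noteq> c" by blast
      then show ?thesis
      proof cases
        case 1 then show ?thesis using sw(3)[of a c c] that \<kappa> by (simp add: \<nu>_def majority_def)
      next
        case 2 then show ?thesis
          using tri[OF sw(1)[of a a b] sw(3)[of a b b]] that cl
          by (simp add: \<nu>_def majority_def)
      next
        case 3 then show ?thesis
          using tri[OF sw(2)[of b b a] sw(3)[of b a a]] that cl
          by (simp add: \<nu>_def majority_def)
      next
        case 4 then show ?thesis
          using that \<kappa> cl by (simp add: \<nu>_def majority_def word_dist_self)
      qed
    qed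
    then show ?thesis using that word_dist_commute cl \<nu>cl by metis
  qed
  have near': "?d (\<mu> a b c) (\<nu> a b c) \<le> 2 * \<kappa>" if "a \<in> ?X" "b \<in> ?X" "c \<in> ?X" for a b c
    using near[OF that] that word_dist_commute cl \<nu>cl by metis
  \<comment> \<open>The worst case is (C2): on each side an inner error \<open>2 * \<kappa>\<close>
    passes through an outer \<open>\<mu>\<close> and is multiplied by \<open>\<kappa>\<close>, which
    gives the quadratic term. The linear errors there add up to \<open>9 * \<kappa>\<close>; the
    rest is slack.\<close>
  let ?k = "4 * \<kappa> * \<kappa> + 20 * \<kappa>"
  have kk: "0 \<le> \<kappa> * \<kappa>" using \<kappa> by simp
  have n0: "?d (\<nu> (a (\<sigma> 1)) (a (\<sigma> 2)) (a (\<sigma> 3))) (\<nu> (a 1) (a 2) (a 3)) \<le> ?k"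
    if a: "\<forall>i\<in>{1,2,3::nat}. a i \<in> ?X" and s: "\<sigma> permutes {1,2,3}" for a \<sigma>
  proof -
    have "\<sigma> i \<in> {1,2,3}" if "i \<in> {1,2,3}" for i
      using permutes_in_image[OF s] that by blast
    then have c: "a (\<sigma> 1) \<in> ?X" "a (\<sigma> 2) \<in> ?X" "a (\<sigma> 3) \<in> ?X" "a 1 \<in> ?X" "a 2 \<in> ?X" "a 3 \<in> ?X"
      using a by blast+
    have "?d (\<nu> (a (\<sigma> 1)) (a (\<sigma> 2)) (a (\<sigma> 3))) (\<nu> (a 1) (a 2) (a 3)) \<le> 2 * \<kappa> + (\<kappa> + 2 * \<kappa>)"
      by (rule tri[OF near tri[OF conjunct2[OF C0[OF a s]] near']]) (use c cl \<nu>cl in auto)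
    then show ?thesis using \<kappa> kk by linarith
  qed
  have n1: "?d (\<nu> a b c) (\<nu> a' b c) \<le> ?k * ?d a a' + ?k"
    if "a \<in> ?X" "a' \<in> ?X" "b \<in> ?X" "c \<in> ?X" for a a' b c
  proof -
    have "?d (\<nu> a b c) (\<nu> a' b c) \<le> 2 * \<kappa> + ((\<kappa> * ?d a a' + \<kappa>) + 2 * \<kappa>)"
      by (rule tri[OF near tri[OF C1 near']]) (use that cl \<nu>cl in auto)
    moreover have "\<kappa> * ?d a a' \<le> ?k * ?d a a'"
      using \<kappa> kk by (intro mult_right_mono word_dist_nonneg) linarith
    ultimately show ?thesis using \<kappa> kk by linarith
  qed
  \<comment> \<open>(C1) varies the first argument; exchanging arguments 1 and 3 before and after
    transfers it to the third, for two further errors \<open>\<kappa>\<close>.\<close>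
  have C3: "?d (\<mu> a b c) (\<mu> a b c') \<le> \<kappa> + ((\<kappa> * ?d c c' + \<kappa>) + \<kappa>)"
    if "a \<in> ?X" "c' \<in> ?X" "b \<in> ?X" "c \<in> ?X" for a c' b c
    by (rule tri[OF sw(2) tri[OF C1 sw(2)]]) (use that cl in auto)
  have n2: "?d (\<nu> (\<nu> a b c) b e) (\<nu> a b (\<nu> c b e)) \<le> ?k"
    if "a \<in> ?X" "b \<in> ?X" "c \<in> ?X" "e \<in> ?X" for a b c e
  proof -
    have m: "\<kappa> * ?d (\<nu> a b c) (\<mu> a b c) \<le> \<kappa> * (2 * \<kappa>)"
      "\<kappa> * ?d (\<mu> c b e) (\<nu> c b e) \<le> \<kappa> * (2 * \<kappa>)"
      using near[of a b c] near'[of c b e] that \<kappa> by (auto intro: mult_left_mono)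
    have 1: "?d (\<nu> (\<nu> a b c) b e) (\<mu> (\<mu> a b c) b e)
        \<le> 2 * \<kappa> + (\<kappa> * ?d (\<nu> a b c) (\<mu> a b c) + \<kappa>)"
      by (rule tri[OF near C1]) (use that cl \<nu>cl in auto)
    have 2: "?d (\<mu> a b (\<mu> c b e)) (\<nu> a b (\<nu> c b e))
        \<le> (\<kappa> + ((\<kappa> * ?d (\<mu> c b e) (\<nu> c b e) + \<kappa>) + \<kappa>)) + 2 * \<kappa>"
      by (rule tri[OF C3 near']) (use that cl \<nu>cl in auto)
    have "?d (\<nu> (\<nu> a b c) b e) (\<nu> a b (\<nu> c b e))
      \<le> (2 * \<kappa> + (\<kappa> * ?d (\<nu> a b c) (\<mu> a b c) + \<kappa>)) + (\<kappa> +
        ((\<kappa> + ((\<kappa> * ?d (\<mu> c b e) (\<nu> c b e) + \<kappa>) + \<kappa>)) + 2 * \<kappa>))"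
      by (rule tri[OF 1 tri[OF C2 2]]) (use that cl \<nu>cl in auto)
    then show ?thesis using m \<kappa> kk by (simp add: algebra_simps)
  qed
  have "strict_coarse_median ?X ?d ?k \<nu>"
    unfolding strict_coarse_median_def
    using \<nu>cl n0 n1 n2 \<kappa> by (auto simp: \<nu>_def majority_def)
  then show ?thesis by blast
qed

section \<open>Normal forms in graph products\<close>

locale vertex_groups =
  fixes V :: "'v set" and adj :: "'v \<Rightarrow> 'v \<Rightarrow> bool" and G :: "'v \<Rightarrow> ('g, 'm) monoid_scheme"
  assumes vertex_group: "u \<in> V \<Longrightarrow> group (G u)"
    and adj_sym: "adj u v \<Longrightarrow> adj v u"
    and adj_irrefl: "\<not> adj u u"
begin

text \<open>The \<open>u\<close>-syllable of a word that can be shuffled to the front, and the word left without it.\<close>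

fun head :: "'v \<Rightarrow> ('v \<times> 'g) list \<Rightarrow> 'g" where
  "head u [] = \<one>\<^bsub>G u\<^esub>"
| "head u ((v, a) # w) = (if v = u then a else if adj u v then head u w else \<one>\<^bsub>G u\<^esub>)"

fun behead :: "'v \<Rightarrow> ('v \<times> 'g) list \<Rightarrow> ('v \<times> 'g) list" where
  "behead u [] = []"
| "behead u ((v, a) # w) =
    (if v = u then w else if adj u v then (v, a) # behead u w else (v, a) # w)"

text \<open>Reduced words. As all syllables are non-trivial, a trivial \<open>head u w\<close> says
  that no later \<open>u\<close>-syllable can be shuffled forward and merged with the first
  letter.\<close>

fun normal_word :: "('v \<times> 'g) list \<Rightarrow> bool" where
  "normal_word [] = True"
| "normal_word ((u, a) # w) \<longleftrightarrow> u \<in> V \<and> a \<in> carrier (G u) \<and> a \<noteq> \<one>\<^bsub>G u\<^esub> \<and>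
    head u w = \<one>\<^bsub>G u\<^esub> \<and> normal_word w"

definition push :: "'v \<Rightarrow> 'g \<Rightarrow> ('v \<times> 'g) list \<Rightarrow> ('v \<times> 'g) list"
  where "push u a w = (if a = \<one>\<^bsub>G u\<^esub> then w else (u, a) # w)"

text \<open>Left multiplication by \<open>a\<close> carried out on reduced words;
  \<open>push\<close> takes care of the case where the syllable cancels.\<close>

definition act :: "'v \<Rightarrow> 'g \<Rightarrow> ('v \<times> 'g) list \<Rightarrow> ('v \<times> 'g) list"
  where "act u a w = push u (a \<otimes>\<^bsub>G u\<^esub> head u w) (behead u w)"

text \<open>Commutation alone, without merging or deletion: for normal words this is precisely the
  ambiguity in the normal form of an element.\<close>

inductive shuffle :: "('v \<times> 'g) list \<Rightarrow> ('v \<times> 'g) list \<Rightarrow> bool" where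
  shuffle_refl: "shuffle w w"
| shuffle_swap: "adj u v \<Longrightarrow> shuffle ((u, a) # (v, b) # w) ((v, b) # (u, a) # w)"
| shuffle_Cons: "shuffle w w' \<Longrightarrow> shuffle (x # w) (x # w')"
| shuffle_trans: "shuffle w w' \<Longrightarrow> shuffle w' w'' \<Longrightarrow> shuffle w w''"

lemma shuffle_sym: "shuffle w w' \<Longrightarrow> shuffle w' w"
  by (induction rule: shuffle.induct) (auto intro: shuffle.intros dest: adj_sym)

lemma head_shuffle: "shuffle w w' \<Longrightarrow> head u w = head u w'"
  by (induction rule: shuffle.induct) (auto simp: adj_irrefl dest: adj_sym)

lemma behead_shuffle: "shuffle w w' \<Longrightarrow> shuffle (behead u w) (behead u w')"
proof (induction rule: shuffle.induct)
  case (shuffle_Cons w w' x)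
  then show ?case by (cases x) (auto intro: shuffle.intros)
qed (auto simp: adj_irrefl intro: shuffle.intros dest: adj_sym)

lemma head_behead_adj: "adj u v \<Longrightarrow> head v (behead u w) = head v w"
  by (induction w rule: head.induct) (auto simp: adj_irrefl dest: adj_sym)

lemma behead_commute: "adj u v \<Longrightarrow> behead u (behead v w) = behead v (behead u w)"
  by (induction w rule: behead.induct) (auto simp: adj_irrefl dest: adj_sym)

lemma normal_word_behead: "normal_word w \<Longrightarrow> normal_word (behead u w)"
  by (induction w rule: normal_word.induct) (auto simp: head_behead_adj)

lemma head_behead: "normal_word w \<Longrightarrow> head u (behead u w) = \<one>\<^bsub>G u\<^esub>"
  by (induction w rule: normal_word.induct) auto

lemma behead_id: "normal_word w \<Longrightarrow> head u w = \<one>\<^bsub>G u\<^esub> \<Longrightarrow> behead u w = w"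
  by (induction w rule: normal_word.induct) (auto split: if_splits)

lemma head_closed: "u \<in> V \<Longrightarrow> normal_word w \<Longrightarrow> head u w \<in> carrier (G u)"
  using vertex_group[THEN group.is_monoid, THEN monoid.one_closed]
  by (induction w rule: normal_word.induct) auto

text \<open>To reach the front, the later of the two syllables would have to cross the earlier one,
  which does not commute with it. All the crosses used later come from this fact.\<close>

lemma head_nonadj:
  "u \<noteq> v \<Longrightarrow> \<not> adj u v \<Longrightarrow> head u w \<noteq> \<one>\<^bsub>G u\<^esub> \<Longrightarrow> head v w = \<one>\<^bsub>G v\<^esub>"
  by (induction w rule: normal_word.induct) (auto split: if_splits dest: adj_sym)

lemma shuffle_push_head: "normal_word w \<Longrightarrow> shuffle w (push u (head u w) (behead u w))"
proof (induction w rule: normal_word.induct)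
  case (2 v a w)
  show ?case
  proof (cases "v \<noteq> u \<and> adj u v \<and> head u w \<noteq> \<one>\<^bsub>G u\<^esub>")
    case True
    have "shuffle ((v, a) # w) ((v, a) # (u, head u w) # behead u w)"
      using 2 True by (auto simp: push_def intro: shuffle.intros)
    moreover have "shuffle ((v, a) # (u, head u w) # behead u w)
        ((u, head u w) # (v, a) # behead u w)"
      using True adj_sym by (auto intro: shuffle.intros)
    ultimately show ?thesis
      using True by (auto simp: push_def intro: shuffle_trans)
  next
    case False
    then show ?thesis
      using 2 by (auto simp: push_def behead_id intro: shuffle_refl)
  qed
qed (auto simp: push_def intro: shuffle.intros)

lemma shuffle_push: "shuffle w w' \<Longrightarrow> shuffle (push u a w) (push u a w')"
  by (auto simp: push_def intro: shuffle.intros)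

lemma act_shuffle: "shuffle w w' \<Longrightarrow> shuffle (act u a w) (act u a w')"
  unfolding act_def using head_shuffle[of w w' u] by (auto intro: shuffle_push behead_shuffle)

lemma normal_word_act:
  assumes "u \<in> V" "a \<in> carrier (G u)" "normal_word w"
  shows "normal_word (act u a w)"
proof -
  interpret group "G u" using assms vertex_group by blast
  show ?thesis using assms head_closed[of u w]
    by (auto simp: act_def push_def normal_word_behead head_behead)
qed

lemma head_act:
  assumes "u \<in> V" "a \<in> carrier (G u)" "normal_word w"
  shows "head u (act u a w) = a \<otimes>\<^bsub>G u\<^esub> head u w"
  using assms by (simp add: act_def push_def head_behead)

lemma behead_act:
  assumes "normal_word w"
  shows "behead u (act u a w) = behead u w"
  using assms by (simp add: act_def push_def behead_id head_behead normal_word_behead)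

lemma act_act:
  assumes "u \<in> V" "a \<in> carrier (G u)" "b \<in> carrier (G u)" "normal_word w"
  shows "act u a (act u b w) = act u (a \<otimes>\<^bsub>G u\<^esub> b) w"
proof -
  interpret group "G u" using assms vertex_group by blast
  show ?thesis
    using assms head_closed[of u w]
    by (subst (1 3) act_def) (simp add: head_act behead_act m_assoc)
qed

text \<open>Acting by the identity still pulls the \<open>u\<close>-syllable to the front, so the
  word itself may change. For this reason the action lives on shuffle classes.\<close>

lemma act_one:
  assumes "u \<in> V" "normal_word w"
  shows "shuffle (act u \<one>\<^bsub>G u\<^esub> w) w"
proof -
  interpret group "G u" using assms vertex_group by blast
  show ?thesis
    using assms head_closed[of u w] shuffle_push_head[of w u]
    by (simp add: act_def shuffle_sym)
qed

lemma head_act_adj: "adj u v \<Longrightarrow> head u (act v b w) = head u w"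
  using adj_sym[of u v] by (auto simp: act_def push_def head_behead_adj adj_irrefl)

lemma behead_act_adj:
  "adj u v \<Longrightarrow> behead u (act v b w) = push v (b \<otimes>\<^bsub>G v\<^esub> head v w) (behead u (behead v w))"
  by (auto simp: act_def push_def adj_irrefl)

lemma act_commute:
  assumes "adj u v"
  shows "shuffle (act u a (act v b w)) (act v b (act u a w))"
proof -
  have "act u a (act v b w) = push u (a \<otimes>\<^bsub>G u\<^esub> head u w)
      (push v (b \<otimes>\<^bsub>G v\<^esub> head v w) (behead u (behead v w)))"
    using assms by (subst act_def) (simp add: head_act_adj behead_act_adj)
  moreover have "act v b (act u a w) = push v (b \<otimes>\<^bsub>G v\<^esub> head v w)
      (push u (a \<otimes>\<^bsub>G u\<^esub> head u w) (behead u (behead v w)))"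
    using assms adj_sym[OF assms]
    by (subst act_def) (simp add: head_act_adj behead_act_adj behead_commute)
  ultimately show ?thesis
    using assms by (auto simp: push_def intro: shuffle.intros)
qed

section \<open>The action of the free product on normal words\<close>

fun word_act :: "('v \<times> 'g) list \<Rightarrow> ('v \<times> 'g) list \<Rightarrow> ('v \<times> 'g) list" where
  "word_act [] r = r"
| "word_act ((u, a) # w) r = act u a (word_act w r)"

lemma word_act_append: "word_act (w @ w') r = word_act w (word_act w' r)"
  by (induction w rule: normal_word.induct) auto

lemma word_act_shuffle: "shuffle r r' \<Longrightarrow> shuffle (word_act w r) (word_act w r')"
  by (induction w rule: normal_word.induct) (auto intro: act_shuffle)

lemma normal_word_word_act: "w \<in> fp_words V G \<Longrightarrow> normal_word r \<Longrightarrow> normal_word (word_act w r)"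
  by (induction w rule: normal_word.induct) (auto intro: normal_word_act)

text \<open>Well-definedness of the action on shuffle classes: multiplying two letters is respected
  exactly by \<open>act_act\<close>, deleting an identity letter up to shuffling by
  \<open>act_one\<close>.\<close>

lemma fp_rel_word_act:
  "(w, w') \<in> fp_rel V G \<Longrightarrow> normal_word r \<Longrightarrow> shuffle (word_act w r) (word_act w' r)"
proof (induction rule: fp_rel.induct)
  case (one x y u)
  then show ?case
    by (simp add: word_act_append word_act_shuffle act_one normal_word_word_act)
next
  case (mult x y u g h)
  then show ?case
    by (simp add: word_act_append act_act normal_word_word_act shuffle_refl)
qed (auto intro: shuffle.intros shuffle_sym)

abbreviation (input) cls :: "('v \<times> 'g) list \<Rightarrow> ('v \<times> 'g) list set"
  where "cls w \<equiv> fp_rel V G `` {w}"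

text \<open>The kernel of the action, tested on one representative; \<open>acts_triviallyD\<close>
  transfers the test to every other one.\<close>

definition acts_trivially :: "('v \<times> 'g) list set \<Rightarrow> bool"
  where "acts_trivially X \<longleftrightarrow>
    (\<exists>w\<in>fp_words V G. X = cls w \<and> (\<forall>r. normal_word r \<longrightarrow> shuffle (word_act w r) r))"

lemma cls_eqD:
  assumes "w \<in> fp_words V G" "w' \<in> fp_words V G" "cls w = cls w'"
  shows "(w, w') \<in> fp_rel V G"
  using assms eq_equiv_class[OF _ fp_rel_equiv] vertex_group by metis

lemma acts_triviallyD:
  assumes "acts_trivially (cls w)" "w \<in> fp_words V G" "normal_word r"
  shows "shuffle (word_act w r) r"
proof -
  obtain w' where w': "w' \<in> fp_words V G" "cls w = cls w'" "shuffle (word_act w' r) r"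
    using assms unfolding acts_trivially_def by blast
  then show ?thesis
    using fp_rel_word_act[OF cls_eqD] assms shuffle_trans by metis
qed

lemma acts_trivially_iff:
  "w \<in> fp_words V G \<Longrightarrow>
    acts_trivially (cls w) \<longleftrightarrow> (\<forall>r. normal_word r \<longrightarrow> shuffle (word_act w r) r)"
  using acts_triviallyD acts_trivially_def by blast

lemma inv_cls:
  assumes "w \<in> fp_words V G" "w' \<in> fp_words V G" "(w' @ w, []) \<in> fp_rel V G"
  shows "inv\<^bsub>free_product V G\<^esub> cls w = cls w'"
proof -
  interpret F: group "free_product V G" using free_product_group vertex_group by blast
  have "cls w' \<otimes>\<^bsub>free_product V G\<^esub> cls w = cls (w' @ w)"
    using free_product_mult_class vertex_group assms by blast
  also have "\<dots> = cls []"
    using equiv_class_eq[OF fp_rel_equiv assms(3)] vertex_group by blast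
  also have "\<dots> = \<one>\<^bsub>free_product V G\<^esub>"
    by (simp add: free_product_def)
  finally show ?thesis
    using assms by (intro F.inv_equality) (auto intro: free_product_carrierI)
qed

text \<open>A kernel is normal, so it contains the normal closure of the relators as soon as it
  contains the relators. This is how the action descends to the graph product.\<close>

lemma acts_trivially_normal:
  "{X \<in> carrier (free_product V G). acts_trivially X} \<lhd> free_product V G"
  (is "?K \<lhd> ?F")
proof -
  interpret F: group ?F using free_product_group vertex_group by blast
  note mult = free_product_mult_class[of V G, OF vertex_group]
  have one: "\<one>\<^bsub>?F\<^esub> = cls []" by (simp add: free_product_def)
  have inverse: thesis
    if X: "X \<in> carrier ?F" and res: "\<And>w w'. w \<in> fp_words V G \<Longrightarrow> w' \<in> fp_words V G \<Longrightarrow> X = cls w \<Longrightarrow>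
      inv\<^bsub>?F\<^esub> X = cls w' \<Longrightarrow> (\<And>r. normal_word r \<Longrightarrow> shuffle (word_act w (word_act w' r)) r) \<Longrightarrow>
      (\<And>r. normal_word r \<Longrightarrow> shuffle (word_act w' (word_act w r)) r) \<Longrightarrow> thesis" for X thesis
  proof -
    obtain w where w: "w \<in> fp_words V G" "X = cls w"
      by (rule free_product_carrierE[OF X])
    obtain w' where w': "w' \<in> fp_words V G" "(w' @ w, []) \<in> fp_rel V G"
      using fp_left_inverse[OF vertex_group w(1)] by blast
    have i: "inv\<^bsub>?F\<^esub> X = cls w'" using inv_cls w w' by simp
    have "cls (w @ w') = cls []"
      using mult[OF _ w(1) w'(1)] F.r_inv[OF X] i w one by simp
    then have "(w @ w', []) \<in> fp_rel V G" using w w' by (intro cls_eqD) auto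
    from fp_rel_word_act[OF this] fp_rel_word_act[OF w'(2)] show thesis
      by (intro res[OF w(1) w'(1) w(2) i]) (auto simp: word_act_append)
  qed
  have sub: "subgroup ?K ?F"
  proof (rule F.subgroupI)
    have "\<one>\<^bsub>?F\<^esub> \<in> ?K" unfolding one by (auto simp: acts_trivially_iff free_product_carrierI shuffle_refl)
    then show "?K \<noteq> {}" by blast
  next
    fix X assume X: "X \<in> ?K"
    then have "X \<in> carrier ?F" by simp
    then show "inv\<^bsub>?F\<^esub> X \<in> ?K"
    proof (rule inverse)
      fix w w' assume w: "w \<in> fp_words V G" "w' \<in> fp_words V G" "X = cls w" "inv\<^bsub>?F\<^esub> X = cls w'"
        and 1: "\<And>r. normal_word r \<Longrightarrow> shuffle (word_act w' (word_act w r)) r"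
      have "shuffle (word_act w' r) r" if "normal_word r" for r
      proof -
        have "shuffle (word_act w r) r"
          using X w that by (auto intro: acts_triviallyD)
        then show ?thesis
          using 1[OF that] word_act_shuffle shuffle_sym shuffle_trans by metis
      qed
      then show "inv\<^bsub>?F\<^esub> X \<in> ?K" using w by (auto simp: acts_trivially_iff intro: free_product_carrierI)
    qed
  next
    fix X Y assume XY: "X \<in> ?K" "Y \<in> ?K"
    then obtain x y where x: "x \<in> fp_words V G" "X = cls x" and y: "y \<in> fp_words V G" "Y = cls y"
      using free_product_carrierE by (metis (mono_tags, lifting) mem_Collect_eq)
    have "shuffle (word_act (x @ y) r) r" if "normal_word r" for r
      using XY x y that acts_triviallyD[of y r] acts_triviallyD[of x r]
      by (auto simp: word_act_append intro: shuffle_trans word_act_shuffle)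
    then show "X \<otimes>\<^bsub>?F\<^esub> Y \<in> ?K"
      using x y by (simp add: mult acts_trivially_iff free_product_carrierI)
  qed auto
  show ?thesis
    unfolding F.normal_inv_iff
  proof (intro conjI ballI sub)
    fix X Y assume X: "X \<in> carrier ?F" and Y: "Y \<in> ?K"
    obtain y where y: "y \<in> fp_words V G" "Y = cls y"
      using Y free_product_carrierE by (metis (mono_tags, lifting) mem_Collect_eq)
    show "X \<otimes>\<^bsub>?F\<^esub> Y \<otimes>\<^bsub>?F\<^esub> inv\<^bsub>?F\<^esub> X \<in> ?K"
      using X
    proof (rule inverse)
      fix w w' assume w: "w \<in> fp_words V G" "w' \<in> fp_words V G" "X = cls w" "inv\<^bsub>?F\<^esub> X = cls w'"
        and 1: "\<And>r. normal_word r \<Longrightarrow> shuffle (word_act w (word_act w' r)) r"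
      have "shuffle (word_act ((w @ y) @ w') r) r" if "normal_word r" for r
      proof -
        have "shuffle (word_act y (word_act w' r)) (word_act w' r)"
          using Y y w that by (auto intro: acts_triviallyD normal_word_word_act)
        then show ?thesis
          using 1[OF that] word_act_shuffle shuffle_trans unfolding word_act_append by metis
      qed
      then have "acts_trivially (cls ((w @ y) @ w'))"
        using w y by (subst acts_trivially_iff) auto
      then show "X \<otimes>\<^bsub>?F\<^esub> Y \<otimes>\<^bsub>?F\<^esub> inv\<^bsub>?F\<^esub> X \<in> ?K"
        using w y by (simp add: mult free_product_carrierI)
    qed
  qed
qed

lemma inv_fp_incl:
  assumes "u \<in> V" "a \<in> carrier (G u)"
  shows "inv\<^bsub>free_product V G\<^esub> cls [(u, a)] = cls [(u, inv\<^bsub>G u\<^esub> a)]"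
proof (rule inv_cls)
  interpret group "G u" using assms vertex_group by blast
  show "[(u, a)] \<in> fp_words V G" "[(u, inv\<^bsub>G u\<^esub> a)] \<in> fp_words V G" using assms by auto
  show "([(u, inv\<^bsub>G u\<^esub> a)] @ [(u, a)], []) \<in> fp_rel V G"
    using fp_rel.mult[of "[]" V G "[]" u "inv\<^bsub>G u\<^esub> a" a] fp_rel.one[of "[]" V G "[]" u] assms
    by (auto intro: fp_rel.trans)
qed

text \<open>Moving \<open>b\<close> past the inverse of \<open>a\<close> by
  \<open>act_commute\<close> brings both pairs of inverse letters together, and what remains acts by
  two identities.\<close>

lemma commutator_acts_trivially:
  assumes "u \<in> V" "v \<in> V" "adj u v" "a \<in> carrier (G u)" "b \<in> carrier (G v)"
  shows "acts_trivially (group_commutator (free_product V G) (cls [(u, a)]) (cls [(v, b)]))"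
proof -
  interpret U: group "G u" using assms vertex_group by blast
  interpret W: group "G v" using assms vertex_group by blast
  let ?w = "[(u, a), (v, b), (u, inv\<^bsub>G u\<^esub> a), (v, inv\<^bsub>G v\<^esub> b)]"
  have eq: "group_commutator (free_product V G) (cls [(u, a)]) (cls [(v, b)]) = cls ?w"
    unfolding group_commutator_def
    using assms by (simp add: inv_fp_incl free_product_mult_class vertex_group)
  have "shuffle (word_act ?w r) r" if r: "normal_word r" for r
  proof -
    let ?r = "act v (inv\<^bsub>G v\<^esub> b) r"
    have n: "normal_word ?r" using assms r by (auto intro: normal_word_act)
    have "shuffle (act v b (act u (inv\<^bsub>G u\<^esub> a) ?r)) (act u (inv\<^bsub>G u\<^esub> a) (act v b ?r))"
      by (rule act_commute) (use assms adj_sym in blast)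
    then have "shuffle (word_act ?w r) (act u a (act u (inv\<^bsub>G u\<^esub> a) (act v b ?r)))"
      by (simp add: act_shuffle)
    also have "act u a (act u (inv\<^bsub>G u\<^esub> a) (act v b ?r)) = act u \<one>\<^bsub>G u\<^esub> (act v \<one>\<^bsub>G v\<^esub> r)"
      using assms n r by (simp add: act_act normal_word_act)
    finally have "shuffle (word_act ?w r) (act u \<one>\<^bsub>G u\<^esub> (act v \<one>\<^bsub>G v\<^esub> r))" .
    moreover have "shuffle (act u \<one>\<^bsub>G u\<^esub> (act v \<one>\<^bsub>G v\<^esub> r)) (act u \<one>\<^bsub>G u\<^esub> r)"
      using assms r by (intro act_shuffle act_one)
    moreover have "shuffle (act u \<one>\<^bsub>G u\<^esub> r) r"
      using assms r by (intro act_one)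
    ultimately show ?thesis using shuffle_trans by blast
  qed
  moreover have "?w \<in> fp_words V G" using assms by auto
  ultimately show ?thesis unfolding eq by (simp add: acts_trivially_iff)
qed

end

section \<open>Syllable length and hyperplanes\<close>

text \<open>
  All that is needed of a graph product \<open>W\<close>: it is generated by commuting copies of the vertex
  groups, and \<open>p u x\<close> is the \<open>u\<close>-syllable of \<open>x\<close> that can be shuffled to the front (\<open>\<one>\<close> if
  there is none).
\<close>

locale head_projections = group W + vertex_groups V adj G
  for W :: "('w, 'n) monoid_scheme" (structure)
    and V :: "'v set" and adj and G :: "'v \<Rightarrow> ('g, 'm) monoid_scheme" +
  fixes \<iota> :: "'v \<Rightarrow> 'g \<Rightarrow> 'w" and p :: "'v \<Rightarrow> 'w \<Rightarrow> 'g"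
  assumes incl_closed [simp]: "u \<in> V \<Longrightarrow> a \<in> carrier (G u) \<Longrightarrow> \<iota> u a \<in> carrier W"
    and incl_mult: "u \<in> V \<Longrightarrow> a \<in> carrier (G u) \<Longrightarrow> b \<in> carrier (G u) \<Longrightarrow>
      \<iota> u (a \<otimes>\<^bsub>G u\<^esub> b) = \<iota> u a \<otimes> \<iota> u b"
    and incl_commute: "u \<in> V \<Longrightarrow> v \<in> V \<Longrightarrow> adj u v \<Longrightarrow> a \<in> carrier (G u) \<Longrightarrow> b \<in> carrier (G v) \<Longrightarrow>
      \<iota> u a \<otimes> \<iota> v b = \<iota> v b \<otimes> \<iota> u a"
    and spanned: "x \<in> carrier W \<Longrightarrow>
      \<exists>ws\<in>fp_words V G. foldr (\<lambda>(u, a) y. \<iota> u a \<otimes> y) ws \<one> = x"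
    and p_closed [simp]: "u \<in> V \<Longrightarrow> x \<in> carrier W \<Longrightarrow> p u x \<in> carrier (G u)"
    and p_one [simp]: "u \<in> V \<Longrightarrow> p u \<one> = \<one>\<^bsub>G u\<^esub>"
    and p_incl_mult [simp]: "u \<in> V \<Longrightarrow> a \<in> carrier (G u) \<Longrightarrow> x \<in> carrier W \<Longrightarrow>
      p u (\<iota> u a \<otimes> x) = a \<otimes>\<^bsub>G u\<^esub> p u x"
    and p_incl_mult_adj: "u \<in> V \<Longrightarrow> v \<in> V \<Longrightarrow> adj u v \<Longrightarrow> b \<in> carrier (G v) \<Longrightarrow> x \<in> carrier W \<Longrightarrow>
      p u (\<iota> v b \<otimes> x) = p u x"
    and p_nonadj: "u \<in> V \<Longrightarrow> v \<in> V \<Longrightarrow> u \<noteq> v \<Longrightarrow> \<not> adj u v \<Longrightarrow> x \<in> carrier W \<Longrightarrow>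
      p u x \<noteq> \<one>\<^bsub>G u\<^esub> \<Longrightarrow> p v x = \<one>\<^bsub>G v\<^esub>"
begin

lemma vertex_monoid_simps [simp]:
  assumes "u \<in> V"
  shows "\<one>\<^bsub>G u\<^esub> \<in> carrier (G u)"
    and "a \<in> carrier (G u) \<Longrightarrow> inv\<^bsub>G u\<^esub> a \<in> carrier (G u)"
    and "a \<in> carrier (G u) \<Longrightarrow> b \<in> carrier (G u) \<Longrightarrow> a \<otimes>\<^bsub>G u\<^esub> b \<in> carrier (G u)"
    and "a \<in> carrier (G u) \<Longrightarrow> a \<otimes>\<^bsub>G u\<^esub> \<one>\<^bsub>G u\<^esub> = a"
    and "a \<in> carrier (G u) \<Longrightarrow> inv\<^bsub>G u\<^esub> a \<otimes>\<^bsub>G u\<^esub> a = \<one>\<^bsub>G u\<^esub>"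
    and "a \<in> carrier (G u) \<Longrightarrow> a \<otimes>\<^bsub>G u\<^esub> inv\<^bsub>G u\<^esub> a = \<one>\<^bsub>G u\<^esub>"
    and "a \<in> carrier (G u) \<Longrightarrow> inv\<^bsub>G u\<^esub> a = \<one>\<^bsub>G u\<^esub> \<longleftrightarrow> a = \<one>\<^bsub>G u\<^esub>"
    and "a \<in> carrier (G u) \<Longrightarrow> b \<in> carrier (G u) \<Longrightarrow> c \<in> carrier (G u) \<Longrightarrow>
      a \<otimes>\<^bsub>G u\<^esub> b = a \<otimes>\<^bsub>G u\<^esub> c \<longleftrightarrow> b = c"
proof -
  interpret U: group "G u" using assms vertex_group by blast
  show "\<one>\<^bsub>G u\<^esub> \<in> carrier (G u)"
    "a \<in> carrier (G u) \<Longrightarrow> inv\<^bsub>G u\<^esub> a \<in> carrier (G u)"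
    "a \<in> carrier (G u) \<Longrightarrow> b \<in> carrier (G u) \<Longrightarrow> a \<otimes>\<^bsub>G u\<^esub> b \<in> carrier (G u)"
    "a \<in> carrier (G u) \<Longrightarrow> a \<otimes>\<^bsub>G u\<^esub> \<one>\<^bsub>G u\<^esub> = a"
    "a \<in> carrier (G u) \<Longrightarrow> inv\<^bsub>G u\<^esub> a \<otimes>\<^bsub>G u\<^esub> a = \<one>\<^bsub>G u\<^esub>"
    "a \<in> carrier (G u) \<Longrightarrow> a \<otimes>\<^bsub>G u\<^esub> inv\<^bsub>G u\<^esub> a = \<one>\<^bsub>G u\<^esub>"
    "a \<in> carrier (G u) \<Longrightarrow> inv\<^bsub>G u\<^esub> a = \<one>\<^bsub>G u\<^esub> \<longleftrightarrow> a = \<one>\<^bsub>G u\<^esub>"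
    "a \<in> carrier (G u) \<Longrightarrow> b \<in> carrier (G u) \<Longrightarrow> c \<in> carrier (G u) \<Longrightarrow>
      a \<otimes>\<^bsub>G u\<^esub> b = a \<otimes>\<^bsub>G u\<^esub> c \<longleftrightarrow> b = c"
    by auto
qed

lemma incl_one [simp]: "u \<in> V \<Longrightarrow> \<iota> u \<one>\<^bsub>G u\<^esub> = \<one>"
  using incl_mult[of u "\<one>\<^bsub>G u\<^esub>" "\<one>\<^bsub>G u\<^esub>"] by (simp add: l_cancel_one')

lemma incl_inv: "u \<in> V \<Longrightarrow> a \<in> carrier (G u) \<Longrightarrow> \<iota> u (inv\<^bsub>G u\<^esub> a) = inv (\<iota> u a)"
  using incl_mult[of u "inv\<^bsub>G u\<^esub> a" a] by (intro inv_equality[symmetric]) auto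

lemma p_incl [simp]: "u \<in> V \<Longrightarrow> a \<in> carrier (G u) \<Longrightarrow> p u (\<iota> u a) = a"
  using p_incl_mult[of u a \<one>] by simp

lemma p_incl_inv_mult [simp]: "u \<in> V \<Longrightarrow> a \<in> carrier (G u) \<Longrightarrow> x \<in> carrier W \<Longrightarrow>
    p u (inv (\<iota> u a) \<otimes> x) = inv\<^bsub>G u\<^esub> a \<otimes>\<^bsub>G u\<^esub> p u x"
  by (simp flip: incl_inv)

lemma p_incl_inv_mult_adj: "u \<in> V \<Longrightarrow> v \<in> V \<Longrightarrow> adj u v \<Longrightarrow> b \<in> carrier (G v) \<Longrightarrow> x \<in> carrier W \<Longrightarrow>
    p u (inv (\<iota> v b) \<otimes> x) = p u x"
  by (simp add: p_incl_mult_adj flip: incl_inv)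

lemma p_incl_neq:
  assumes "u \<in> V" "v \<in> V" "u \<noteq> v" "a \<in> carrier (G v)"
  shows "p u (\<iota> v a) = \<one>\<^bsub>G u\<^esub>"
proof (cases "adj u v \<or> a = \<one>\<^bsub>G v\<^esub>")
  case True
  then show ?thesis using assms p_incl_mult_adj[of u v a \<one>] by auto
next
  case False
  then show ?thesis using assms p_nonadj[of v u "\<iota> v a"] adj_sym by auto
qed

section \<open>Syllable length and front syllables\<close>

fun val :: "('v \<times> 'g) list \<Rightarrow> 'w" where
  "val [] = \<one>"
| "val ((u, a) # w) = \<iota> u a \<otimes> val w"

lemma val_closed: "w \<in> fp_words V G \<Longrightarrow> val w \<in> carrier W"
  by (induction w rule: val.induct) auto

lemma val_append:
  "w \<in> fp_words V G \<Longrightarrow> w' \<in> fp_words V G \<Longrightarrow> val (w @ w') = val w \<otimes> val w'"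
  by (induction w rule: val.induct) (auto simp: m_assoc val_closed)

lemma val_exists:
  assumes "x \<in> carrier W"
  shows "\<exists>w\<in>fp_words V G. val w = x"
proof -
  have "val w = foldr (\<lambda>(u, a) y. \<iota> u a \<otimes> y) w \<one>" for w
    by (induction w rule: val.induct) auto
  then show ?thesis using spanned[OF assms] by auto
qed

lemma val_inv:
  "w \<in> fp_words V G \<Longrightarrow> \<exists>w'\<in>fp_words V G. length w' = length w \<and> val w' = inv (val w)"
proof (induction w rule: val.induct)
  case (2 u a w)
  then obtain w' where w': "w' \<in> fp_words V G" "length w' = length w" "val w' = inv (val w)"
    by auto
  have "val (w' @ [(u, inv\<^bsub>G u\<^esub> a)]) = inv (val ((u, a) # w))"
    using 2 w' by (simp add: val_append incl_inv inv_mult_group val_closed)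
  moreover have "w' @ [(u, inv\<^bsub>G u\<^esub> a)] \<in> fp_words V G"
    "length (w' @ [(u, inv\<^bsub>G u\<^esub> a)]) = length ((u, a) # w)"
    using 2 w' by auto
  ultimately show ?case by blast
qed (simp add: bexI[of _ "[]"])

text \<open>Word length for the generating set formed by all vertex groups together, that is,
  distance from the identity in the quasi-median Cayley graph. It carries the inductions because
  each hyperplane crossed counts once, however long the syllable is.\<close>

definition syl :: "'w \<Rightarrow> nat"
  where "syl x = (LEAST n. \<exists>w\<in>fp_words V G. val w = x \<and> length w = n)"

lemma syl_le: "w \<in> fp_words V G \<Longrightarrow> syl (val w) \<le> length w"
  unfolding syl_def by (rule Least_le) blast

lemma syl_attained:
  assumes "x \<in> carrier W"
  obtains w where "w \<in> fp_words V G" "val w = x" "length w = syl x"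
proof -
  have "\<exists>n. \<exists>w\<in>fp_words V G. val w = x \<and> length w = n" using val_exists[OF assms] by blast
  then have "\<exists>w\<in>fp_words V G. val w = x \<and> length w = syl x"
    unfolding syl_def by (rule LeastI_ex)
  then show thesis using that by blast
qed

lemma syl_one [simp]: "syl \<one> = 0"
  using syl_le[of "[]"] by simp

lemma syl_incl_mult:
  assumes "u \<in> V" "a \<in> carrier (G u)" "x \<in> carrier W"
  shows "syl (\<iota> u a \<otimes> x) \<le> Suc (syl x)"
proof -
  obtain w where "w \<in> fp_words V G" "val w = x" "length w = syl x"
    by (rule syl_attained[OF assms(3)])
  then show ?thesis using syl_le[of "(u, a) # w"] assms by simp
qed

lemma syl_inv:
  assumes "x \<in> carrier W"
  shows "syl (inv x) = syl x"
proof -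
  have "syl (inv y) \<le> syl y" if y: "y \<in> carrier W" for y
  proof -
    obtain w where "w \<in> fp_words V G" "val w = y" "length w = syl y"
      by (rule syl_attained[OF y])
    then show ?thesis using val_inv[of w] syl_le by metis
  qed
  from this[of x] this[of "inv x"] show ?thesis using assms by simp
qed

lemma syl_inv_mult:
  assumes "x \<in> carrier W" "y \<in> carrier W"
  shows "syl (inv x \<otimes> y) = syl (inv y \<otimes> x)"
  using syl_inv[of "inv x \<otimes> y"] assms by (simp add: inv_mult_group)

lemma syl_mult_incl:
  assumes "u \<in> V" "a \<in> carrier (G u)" "x \<in> carrier W"
  shows "syl (x \<otimes> \<iota> u a) \<le> Suc (syl x)"
  using syl_incl_mult[of u "inv\<^bsub>G u\<^esub> a" "inv x"] syl_inv[of "x \<otimes> \<iota> u a"] syl_inv[of x] assms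
  by (simp add: inv_mult_group incl_inv)

lemma peel:
  assumes "x \<in> carrier W" "x \<noteq> \<one>"
  obtains w t y where "w \<in> V" "t \<in> carrier (G w)" "y \<in> carrier W"
    "x = \<iota> w t \<otimes> y" "syl x = Suc (syl y)"
proof -
  obtain ws where ws: "ws \<in> fp_words V G" "val ws = x" "length ws = syl x"
    by (rule syl_attained[OF assms(1)])
  then obtain w t ws' where c: "ws = (w, t) # ws'"
    using assms(2) by (metis val.elims)
  then have *: "w \<in> V" "t \<in> carrier (G w)" "ws' \<in> fp_words V G" "x = \<iota> w t \<otimes> val ws'"
    using ws by auto
  have "syl x \<le> Suc (syl (val ws'))"
    using syl_incl_mult * val_closed by simp
  moreover have "syl (val ws') \<le> length ws'" using syl_le * by blast
  ultimately have "syl x = Suc (syl (val ws'))" using ws c by simp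
  then show thesis using that * val_closed by blast
qed

text \<open>The link between \<open>p\<close> and geodesics: a non-trivial front syllable starts
  some shortest word. Compare it with the first syllable \<open>t\<close> of any shortest word:
  labels agree, or they commute and induction applies behind \<open>t\<close>, or
  \<open>p_nonadj\<close> rules the case out.\<close>

lemma syl_head:
  assumes "u \<in> V" "x \<in> carrier W" "p u x \<noteq> \<one>\<^bsub>G u\<^esub>"
  shows "syl x = Suc (syl (inv (\<iota> u (p u x)) \<otimes> x))"
  using assms
proof (induction "syl x" arbitrary: x u rule: less_induct)
  case less
  have "x \<noteq> \<one>" using less.prems by auto
  then obtain w t y where wty: "w \<in> V" "t \<in> carrier (G w)" "y \<in> carrier W"
    "x = \<iota> w t \<otimes> y" "syl x = Suc (syl y)"
    using peel less.prems(2) by metis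
  \<comment> \<open>A front syllable of \<open>y\<close> with the label of \<open>t\<close> could be
    merged with \<open>t\<close>, which would spell \<open>x\<close> with only \<open>syl y\<close>
    syllables.\<close>
  have py: "p w y = \<one>\<^bsub>G w\<^esub>"
  proof (rule ccontr)
    assume ne: "p w y \<noteq> \<one>\<^bsub>G w\<^esub>"
    let ?y = "inv (\<iota> w (p w y)) \<otimes> y"
    have s: "syl y = Suc (syl ?y)"
      using less.hyps[of y w] wty ne by simp
    have "x = \<iota> w (t \<otimes>\<^bsub>G w\<^esub> p w y) \<otimes> ?y"
      using wty by (simp add: incl_mult m_assoc) (simp add: m_assoc[symmetric])
    then have "syl x \<le> Suc (syl ?y)"
      using syl_incl_mult[of w "t \<otimes>\<^bsub>G w\<^esub> p w y" ?y] wty by simp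
    then show False using s wty by simp
  qed
  then have px: "p w x = t" using wty by simp
  consider "u = w" | "u \<noteq> w" "adj u w" | "u \<noteq> w" "\<not> adj u w" by blast
  then show ?case
  proof cases
    case 1
    then have "inv (\<iota> u (p u x)) \<otimes> x = y"
      using wty px by (simp add: m_assoc[symmetric])
    then show ?thesis using wty by simp
  next
    case 2
    then have pu: "p u x = p u y" using wty less.prems p_incl_mult_adj by simp
    let ?i = "inv (\<iota> u (p u x))"
    have c: "?i \<in> carrier W" using less.prems by simp
    have s: "syl y = Suc (syl (?i \<otimes> y))"
      using less.hyps[of y u] wty less.prems pu by simp
    have "?i \<otimes> x = \<iota> w t \<otimes> (?i \<otimes> y)"
      using incl_commute[of u w "inv\<^bsub>G u\<^esub> (p u x)" t] 2 wty(1-4) less.prems c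
      by (simp add: incl_inv m_assoc[symmetric])
    then have "syl (?i \<otimes> x) \<le> syl y"
      using syl_incl_mult[of w t "?i \<otimes> y"] wty c s by simp
    moreover have "syl x \<le> Suc (syl (?i \<otimes> x))"
      using syl_incl_mult[of u "p u x" "?i \<otimes> x"] less.prems c by (simp add: m_assoc[symmetric])
    ultimately show ?thesis using wty by simp
  next
    case 3
    then have "p w x = \<one>\<^bsub>G w\<^esub>" using p_nonadj less.prems wty(1) by blast
    then have "t = \<one>\<^bsub>G w\<^esub>" using px by simp
    then have "x = y" using wty(1-4) by simp
    then show ?thesis using wty(5) by simp
  qed
qed

lemma syl_incl_mult_Suc:
  assumes "u \<in> V" "a \<in> carrier (G u)" "a \<noteq> \<one>\<^bsub>G u\<^esub>" "x \<in> carrier W" "p u x = \<one>\<^bsub>G u\<^esub>"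
  shows "syl (\<iota> u a \<otimes> x) = Suc (syl x)"
  using syl_head[of u "\<iota> u a \<otimes> x"] assms by (simp add: m_assoc[symmetric])

text \<open>The first syllable of a shortest word is the whole front syllable of its label: a
  further syllable of that label at the front would merge with it and save a letter.\<close>

lemma p_of_syl_Suc:
  assumes "u \<in> V" "a \<in> carrier (G u)" "x \<in> carrier W" "syl (\<iota> u a \<otimes> x) = Suc (syl x)"
  shows "p u x = \<one>\<^bsub>G u\<^esub>" "p u (\<iota> u a \<otimes> x) = a" "a \<noteq> \<one>\<^bsub>G u\<^esub>"
proof -
  show 1: "p u x = \<one>\<^bsub>G u\<^esub>"
  proof (rule ccontr)
    assume ne: "p u x \<noteq> \<one>\<^bsub>G u\<^esub>"
    let ?x = "inv (\<iota> u (p u x)) \<otimes> x"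
    have "syl (\<iota> u (a \<otimes>\<^bsub>G u\<^esub> p u x) \<otimes> ?x) \<le> Suc (syl ?x)"
      using assms by (intro syl_incl_mult) auto
    also have "\<iota> u (a \<otimes>\<^bsub>G u\<^esub> p u x) \<otimes> ?x = \<iota> u a \<otimes> x"
      using assms by (simp add: incl_mult m_assoc) (simp add: m_assoc[symmetric])
    finally show False using syl_head[of u x] ne assms by simp
  qed
  show "p u (\<iota> u a \<otimes> x) = a" using 1 assms by simp
  show "a \<noteq> \<one>\<^bsub>G u\<^esub>" using assms by auto
qed

text \<open>
  No cancellation takes place in the product \<open>k\<inverse> x\<close>, so it starts with the inverse of the last
  syllable of \<open>k\<close>.
\<close>

lemma p_inv_mult_last:
  assumes "k \<in> carrier W" "v \<in> V" "s \<in> carrier (G v)" "x \<in> carrier W"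
    and "syl (k \<otimes> \<iota> v s) = Suc (syl k)"
    and "\<And>w. w \<in> V \<Longrightarrow> p w (k \<otimes> \<iota> v s) \<noteq> \<one>\<^bsub>G w\<^esub> \<Longrightarrow> p w x = \<one>\<^bsub>G w\<^esub>"
  shows "p v (inv (k \<otimes> \<iota> v s) \<otimes> x) \<noteq> \<one>\<^bsub>G v\<^esub>"
  using assms
proof (induction "syl k" arbitrary: k x rule: less_induct)
  case less
  note kc = less.prems(1) and v = less.prems(2) and s = less.prems(3) and x = less.prems(4)
  show ?case
  proof (cases "k = \<one>")
    case True
    then have "syl (\<iota> v s \<otimes> \<one>) = Suc (syl \<one>)" using less.prems by simp
    then have "s \<noteq> \<one>\<^bsub>G v\<^esub>" using p_of_syl_Suc(3) v s by blast
    moreover have "p v x = \<one>\<^bsub>G v\<^esub>"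
      using less.prems(6)[of v] True v s calculation by simp
    ultimately show ?thesis using True v s x by simp
  next
    case False
    then obtain w t y where wty: "w \<in> V" "t \<in> carrier (G w)" "y \<in> carrier W"
      "k = \<iota> w t \<otimes> y" "syl k = Suc (syl y)"
      using peel kc by metis
    let ?k = "y \<otimes> \<iota> v s"
    have keq: "k \<otimes> \<iota> v s = \<iota> w t \<otimes> ?k" using wty v s by (simp add: m_assoc)
    have "syl (\<iota> w t \<otimes> ?k) \<le> Suc (syl ?k)" "syl ?k \<le> Suc (syl y)"
      using wty v s by (auto intro!: syl_incl_mult syl_mult_incl)
    then have k: "syl ?k = Suc (syl y)" "syl (\<iota> w t \<otimes> ?k) = Suc (syl ?k)"
      using less.prems(5) keq wty by auto
    note t = p_of_syl_Suc[OF wty(1,2) _ k(2)]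
    have pk: "p w ?k = \<one>\<^bsub>G w\<^esub>" "p w (\<iota> w t \<otimes> ?k) = t" "t \<noteq> \<one>\<^bsub>G w\<^esub>"
      using t wty v s by auto
    have pwx: "p w x = \<one>\<^bsub>G w\<^esub>" using less.prems(6)[OF wty(1)] keq pk by simp
    let ?x = "inv (\<iota> w t) \<otimes> x"
    \<comment> \<open>The hypothesis on front syllables has to pass to the remaining factors. A
      label adjacent to \<open>w\<close> is already at the front of the original product, hence not
      at the front of \<open>x\<close>. Any other label is blocked in \<open>?x\<close> by the new
      front syllable of label \<open>w\<close>.\<close>
    have "p z ?x = \<one>\<^bsub>G z\<^esub>" if z: "z \<in> V" "p z ?k \<noteq> \<one>\<^bsub>G z\<^esub>" for z
    proof -
      have "z \<noteq> w" using z pk by auto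
      show ?thesis
      proof (cases "adj z w")
        case True
        then have "p z (k \<otimes> \<iota> v s) = p z ?k"
          using keq p_incl_mult_adj z wty v s by simp
        then show ?thesis
          using less.prems(6)[of z] z True p_incl_inv_mult_adj wty x by simp
      next
        case False
        have "p w ?x \<noteq> \<one>\<^bsub>G w\<^esub>" using pwx wty x pk by simp
        then show ?thesis
          using p_nonadj[of w z ?x] False \<open>z \<noteq> w\<close> adj_sym[of w z] z wty x by auto
      qed
    qed
    then have "p v (inv ?k \<otimes> ?x) \<noteq> \<one>\<^bsub>G v\<^esub>"
      using wty x v s k by (intro less.hyps) auto
    then show ?thesis
      using wty x v s keq by (simp add: inv_mult_group m_assoc)
  qed
qed

text \<open>As \<open>k\<close> does not end in a \<open>u\<close>-syllable, appending a non-trivial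
  one lengthens it by exactly one, so the first syllable of \<open>k\<close> keeps its place. One
  label \<open>w\<close> thus serves all \<open>c\<close>.\<close>

lemma p_mult_incl_first:
  assumes "k \<in> carrier W" "k \<noteq> \<one>" "u \<in> V" "p u (inv k) = \<one>\<^bsub>G u\<^esub>"
  obtains w where "w \<in> V" "\<And>c. c \<in> carrier (G u) \<Longrightarrow> p w (k \<otimes> \<iota> u c) \<noteq> \<one>\<^bsub>G w\<^esub>"
proof -
  obtain w t y where wty: "w \<in> V" "t \<in> carrier (G w)" "y \<in> carrier W"
    "k = \<iota> w t \<otimes> y" "syl k = Suc (syl y)"
    using peel assms by metis
  have "p w (k \<otimes> \<iota> u c) \<noteq> \<one>\<^bsub>G w\<^esub>" if c: "c \<in> carrier (G u)" for c
  proof (cases "c = \<one>\<^bsub>G u\<^esub>")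
    case True
    then show ?thesis using p_of_syl_Suc[of w t y] wty assms by simp
  next
    case False
    have keq: "k \<otimes> \<iota> u c = \<iota> w t \<otimes> (y \<otimes> \<iota> u c)"
      using wty assms c by (simp add: m_assoc)
    have "syl (k \<otimes> \<iota> u c) = syl (\<iota> u (inv\<^bsub>G u\<^esub> c) \<otimes> inv k)"
      using syl_inv[of "k \<otimes> \<iota> u c"] assms c by (simp add: inv_mult_group incl_inv)
    also have "\<dots> = Suc (syl k)"
      using assms c False syl_inv[of k] by (subst syl_incl_mult_Suc) auto
    finally have "syl (\<iota> w t \<otimes> (y \<otimes> \<iota> u c)) = Suc (Suc (syl y))" using keq wty by simp
    moreover have "syl (y \<otimes> \<iota> u c) \<le> Suc (syl y)"
      "syl (\<iota> w t \<otimes> (y \<otimes> \<iota> u c)) \<le> Suc (syl (y \<otimes> \<iota> u c))"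
      using wty assms c by (auto intro!: syl_incl_mult syl_mult_incl)
    ultimately have "syl (\<iota> w t \<otimes> (y \<otimes> \<iota> u c)) = Suc (syl (y \<otimes> \<iota> u c))" by simp
    then show ?thesis using p_of_syl_Suc[of w t "y \<otimes> \<iota> u c"] wty assms c keq by simp
  qed
  then show thesis using that wty by blast
qed

text \<open>
  A hyperplane of label \<open>u\<close> is a coset of the subgroup generated by the star of \<open>u\<close>.  It is encoded
  by the coordinate in \<open>G u\<close> that it defines, normalised to be trivial at \<open>\<one>\<close> so as not to depend on
  the representative \<open>g\<close> of the coset.
\<close>

definition coord :: "'w \<Rightarrow> 'v \<Rightarrow> 'w \<Rightarrow> 'g"
  where "coord g u = (\<lambda>x\<in>carrier W. inv\<^bsub>G u\<^esub> (p u (inv g)) \<otimes>\<^bsub>G u\<^esub> p u (inv g \<otimes> x))"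

definition hyperplanes :: "('v \<times> ('w \<Rightarrow> 'g)) set"
  where "hyperplanes = {(u, coord g u) | u g. u \<in> V \<and> g \<in> carrier W}"

definition separating :: "'w \<Rightarrow> 'w \<Rightarrow> ('v \<times> ('w \<Rightarrow> 'g)) set"
  where "separating x y = {(u, f) \<in> hyperplanes. f x \<noteq> f y}"

lemma coord_closed: "u \<in> V \<Longrightarrow> g \<in> carrier W \<Longrightarrow> x \<in> carrier W \<Longrightarrow> coord g u x \<in> carrier (G u)"
  by (simp add: coord_def)

lemma coord_eq_iff:
  "u \<in> V \<Longrightarrow> g \<in> carrier W \<Longrightarrow> x \<in> carrier W \<Longrightarrow> y \<in> carrier W \<Longrightarrow>
    coord g u x = coord g u y \<longleftrightarrow> p u (inv g \<otimes> x) = p u (inv g \<otimes> y)"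
  by (simp add: coord_def)

lemma hyperplanes_closed: "(u, f) \<in> hyperplanes \<Longrightarrow> x \<in> carrier W \<Longrightarrow> f x \<in> carrier (G u)"
  by (auto simp: hyperplanes_def coord_closed)

text \<open>A factor from a neighbour of \<open>u\<close> is invisible to \<open>p u\<close>. A
  factor from \<open>G u\<close> changes both terms of \<open>coord\<close> by the same left
  multiplication, which the normalisation cancels.\<close>

lemma coord_shift:
  assumes "u \<in> V" "w \<in> V" "w = u \<or> adj u w" "s \<in> carrier (G w)" "g \<in> carrier W"
  shows "coord (g \<otimes> \<iota> w s) u = coord g u"
proof -
  interpret U: group "G u" using assms vertex_group by blast
  have "inv\<^bsub>G u\<^esub> (inv\<^bsub>G u\<^esub> s \<otimes>\<^bsub>G u\<^esub> p u (inv g)) \<otimes>\<^bsub>G u\<^esub> (inv\<^bsub>G u\<^esub> s \<otimes>\<^bsub>G u\<^esub> p u (inv g \<otimes> x))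
      = inv\<^bsub>G u\<^esub> (p u (inv g)) \<otimes>\<^bsub>G u\<^esub> p u (inv g \<otimes> x)" if "x \<in> carrier W" "w = u" for x
    using that assms by (simp add: U.inv_mult_group U.m_assoc) (simp add: U.m_assoc[symmetric])
  then show ?thesis
    using assms unfolding coord_def
    by (intro restrict_ext) (auto simp: inv_mult_group m_assoc p_incl_inv_mult_adj)
qed

text \<open>Take a base point \<open>h\<close> of the hyperplane closest to \<open>m\<close>. If
  \<open>inv h \<otimes> m\<close> started with a syllable from the star of \<open>u\<close>,
  multiplying \<open>h\<close> by it would give a closer one.\<close>

lemma gate:
  assumes "u \<in> V" "g \<in> carrier W" "m \<in> carrier W"
  obtains h where "h \<in> carrier W" "coord h u = coord g u"
    "\<And>w. w \<in> V \<Longrightarrow> w = u \<or> adj u w \<Longrightarrow> p w (inv h \<otimes> m) = \<one>\<^bsub>G w\<^esub>"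
proof -
  let ?P = "\<lambda>h. h \<in> carrier W \<and> coord h u = coord g u"
  obtain h where h: "?P h" "\<And>h'. ?P h' \<Longrightarrow> syl (inv h \<otimes> m) \<le> syl (inv h' \<otimes> m)"
    using ex_has_least_nat[of ?P g "\<lambda>h. syl (inv h \<otimes> m)"] assms by blast
  have "p w (inv h \<otimes> m) = \<one>\<^bsub>G w\<^esub>" if w: "w \<in> V" "w = u \<or> adj u w" for w
  proof (rule ccontr)
    let ?b = "p w (inv h \<otimes> m)"
    assume "?b \<noteq> \<one>\<^bsub>G w\<^esub>"
    then have "syl (inv h \<otimes> m) = Suc (syl (inv (\<iota> w ?b) \<otimes> (inv h \<otimes> m)))"
      using w h assms by (intro syl_head) auto
    also have "inv (\<iota> w ?b) \<otimes> (inv h \<otimes> m) = inv (h \<otimes> \<iota> w ?b) \<otimes> m"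
      using w h assms by (simp add: inv_mult_group m_assoc)
    finally have "syl (inv h \<otimes> m) = Suc (syl (inv (h \<otimes> \<iota> w ?b) \<otimes> m))" .
    moreover have "?P (h \<otimes> \<iota> w ?b)" using coord_shift w h assms by simp
    ultimately show False using h(2) by fastforce
  qed
  then show thesis using that h by blast
qed

lemma split_last:
  assumes "u \<in> V" "k \<in> carrier W"
  obtains l b where "l \<in> carrier W" "b \<in> carrier (G u)" "k = l \<otimes> \<iota> u b" "p u (inv l) = \<one>\<^bsub>G u\<^esub>"
proof -
  obtain b where b: "b = p u (inv k)" by simp
  have bc: "b \<in> carrier (G u)" using b assms by simp
  have "k = (k \<otimes> \<iota> u b) \<otimes> \<iota> u (inv\<^bsub>G u\<^esub> b)"
    using bc assms by (simp add: incl_inv m_assoc)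
  moreover have "p u (inv (k \<otimes> \<iota> u b)) = \<one>\<^bsub>G u\<^esub>"
    using bc assms b by (simp add: inv_mult_group)
  ultimately show thesis using that[of "k \<otimes> \<iota> u b" "inv\<^bsub>G u\<^esub> b"] bc assms by simp
qed

text \<open>Look at the edge from the gate \<open>h\<close> of the hyperplane. Either the edge
  starts at \<open>h\<close>, or \<open>k\<close> starts with a syllable outside the star of
  \<open>v\<close> that, unless \<open>k\<close> lies in \<open>G u\<close>, survives along the edge
  and keeps the \<open>v\<close>-coordinate trivial.\<close>

lemma coord_edge:
  assumes "u \<in> V" "v \<in> V" "g \<in> carrier W" "m \<in> carrier W" "s \<in> carrier (G u)"
    and ne: "coord g v m \<noteq> coord g v (m \<otimes> \<iota> u s)"
  shows "v = u \<and> coord g v = coord m u"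
proof -
  obtain h where h: "h \<in> carrier W" "coord h v = coord g v"
    "\<And>w. w \<in> V \<Longrightarrow> w = v \<or> adj v w \<Longrightarrow> p w (inv h \<otimes> m) = \<one>\<^bsub>G w\<^esub>"
    using gate assms by metis
  obtain k where k: "k = inv h \<otimes> m" by simp
  then have kc: "k \<in> carrier W" using h assms by simp
  have "p v (inv h \<otimes> m) \<noteq> p v (inv h \<otimes> (m \<otimes> \<iota> u s))"
    using ne coord_eq_iff[of v h m "m \<otimes> \<iota> u s"] h(1,2) assms(1-5) by simp
  then have ne': "p v k \<noteq> p v (k \<otimes> \<iota> u s)" using k h(1) assms(1-5) by (simp add: m_assoc)
  show ?thesis
  proof (cases "k = \<one>")
    case True
    then have "h = m" using k h(1) assms(4) by (metis inv_closed inv_equality inv_inv)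
    moreover have "v = u" using ne' True p_incl_neq[of v u s] assms by auto
    ultimately show ?thesis using h by simp
  next
    case False
    \<comment> \<open>The factor \<open>l\<close> is common to both ends of the edge, which differ
      only in the \<open>u\<close>-syllable after it; hence they share the first syllable of
      \<open>l\<close>.\<close>
    obtain l b where l: "l \<in> carrier W" "b \<in> carrier (G u)" "k = l \<otimes> \<iota> u b" "p u (inv l) = \<one>\<^bsub>G u\<^esub>"
      using split_last[OF assms(1) kc] by blast
    have ks: "k \<otimes> \<iota> u s = l \<otimes> \<iota> u (b \<otimes>\<^bsub>G u\<^esub> s)"
      using l(1-3) assms(1,5) by (simp add: m_assoc incl_mult)
    have pv: "p v k = \<one>\<^bsub>G v\<^esub>" using h(3)[of v] k assms(2) by simp
    have "p v (k \<otimes> \<iota> u s) = \<one>\<^bsub>G v\<^esub>"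
    proof (cases "l = \<one>")
      case True
      then have "k = \<iota> u b" using l(2,3) assms(1) by simp
      then have "p u k \<noteq> \<one>\<^bsub>G u\<^esub>" using False l(2) assms(1) by auto
      then have "v \<noteq> u" using pv by auto
      then show ?thesis using p_incl_neq[of v u "b \<otimes>\<^bsub>G u\<^esub> s"] ks True l(2) assms(1,2,5) by simp
    next
      case nl: False
      obtain w where w: "w \<in> V" "\<And>c. c \<in> carrier (G u) \<Longrightarrow> p w (l \<otimes> \<iota> u c) \<noteq> \<one>\<^bsub>G w\<^esub>"
        using p_mult_incl_first[OF l(1) nl assms(1) l(4)] by blast
      have "p w k \<noteq> \<one>\<^bsub>G w\<^esub>" using w(2)[OF l(2)] l(3) by simp
      then have "w \<noteq> v" "\<not> adj v w" using h(3)[OF w(1)] k by auto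
      moreover have "p w (k \<otimes> \<iota> u s) \<noteq> \<one>\<^bsub>G w\<^esub>"
        unfolding ks by (rule w(2)) (use l assms in simp)
      ultimately show ?thesis
        using p_nonadj[of w v "k \<otimes> \<iota> u s"] w(1) adj_sym[of w v] kc assms(1,2,5) by auto
    qed
    then show ?thesis using ne' pv by simp
  qed
qed

section \<open>Separating hyperplanes and geodesics\<close>

lemma separating_edge:
  assumes "u \<in> V" "m \<in> carrier W" "s \<in> carrier (G u)"
  shows "separating m (m \<otimes> \<iota> u s) \<subseteq> {(u, coord m u)}"
proof
  fix J assume "J \<in> separating m (m \<otimes> \<iota> u s)"
  then obtain v g where J: "J = (v, coord g v)" "v \<in> V" "g \<in> carrier W"
    "coord g v m \<noteq> coord g v (m \<otimes> \<iota> u s)"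
    by (auto simp: separating_def hyperplanes_def)
  show "J \<in> {(u, coord m u)}"
    using coord_edge[OF assms(1) J(2,3) assms(2,3) J(4)] J(1) by blast
qed

lemma separating_triangle: "separating x z \<subseteq> separating x y \<union> separating y z"
  by (auto simp: separating_def)

lemma coord_mult_incl:
  "u \<in> V \<Longrightarrow> g \<in> carrier W \<Longrightarrow> s \<in> carrier (G u) \<Longrightarrow> coord g u (g \<otimes> \<iota> u s) = coord g u g \<otimes>\<^bsub>G u\<^esub> s"
  by (simp add: coord_def m_assoc[symmetric])

text \<open>Since \<open>t\<close> is the whole front syllable of \<open>inv x \<otimes> y\<close>,
  the crossed coordinate reaches its final value in one step. A geodesic thus crosses each
  separating hyperplane once, and no other.\<close>

lemma separating_peel:
  assumes "x \<in> carrier W" "y \<in> carrier W" "k \<in> carrier W" "w \<in> V" "t \<in> carrier (G w)"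
    and eq: "inv x \<otimes> y = \<iota> w t \<otimes> k" and Suc: "syl (inv x \<otimes> y) = Suc (syl k)"
  shows "separating x y = insert (w, coord x w) (separating (x \<otimes> \<iota> w t) y)"
    and "(w, coord x w) \<notin> separating (x \<otimes> \<iota> w t) y"
    and "coord x w x \<noteq> coord x w y"
    and "coord x w y = coord x w x \<otimes>\<^bsub>G w\<^esub> t"
proof -
  let ?x = "x \<otimes> \<iota> w t"
  note pk = p_of_syl_Suc[OF assms(4,5,3) Suc[unfolded eq]]
  have J: "(w, coord x w) \<in> hyperplanes" using assms(1,4) by (auto simp: hyperplanes_def)
  show 4: "coord x w y = coord x w x \<otimes>\<^bsub>G w\<^esub> t"
    using assms(1,2,4) pk(2) eq by (simp add: coord_def)
  show 3: "coord x w x \<noteq> coord x w y"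
    using assms(1,2,4) pk(2,3) eq by (simp add: coord_eq_iff)
  show 2: "(w, coord x w) \<notin> separating ?x y"
    using 4 coord_mult_incl[OF assms(4,1,5)] by (simp add: separating_def)
  have e: "separating x ?x \<subseteq> {(w, coord x w)}" using separating_edge[OF assms(4,1,5)] .
  have "separating ?x y \<subseteq> separating x y"
  proof
    fix J assume J: "J \<in> separating ?x y"
    then have "J \<notin> separating x ?x" using e 2 by blast
    then show "J \<in> separating x y" using J by (auto simp: separating_def)
  qed
  moreover have "(w, coord x w) \<in> separating x y" using 3 J by (simp add: separating_def)
  ultimately show "separating x y = insert (w, coord x w) (separating ?x y)"
    using e separating_triangle[of x y ?x] by blast
qed

lemma separating_self [simp]: "separating x x = {}"
  by (auto simp: separating_def)

lemma path_induct [consumes 2, case_names refl step]: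
  assumes "x \<in> carrier W" "y \<in> carrier W"
    and refl: "\<And>x. x \<in> carrier W \<Longrightarrow> P x x"
    and step: "\<And>x y k w t. x \<in> carrier W \<Longrightarrow> y \<in> carrier W \<Longrightarrow> k \<in> carrier W \<Longrightarrow> w \<in> V \<Longrightarrow>
      t \<in> carrier (G w) \<Longrightarrow> inv x \<otimes> y = \<iota> w t \<otimes> k \<Longrightarrow> inv (x \<otimes> \<iota> w t) \<otimes> y = k \<Longrightarrow>
      syl (inv x \<otimes> y) = Suc (syl k) \<Longrightarrow> P (x \<otimes> \<iota> w t) y \<Longrightarrow> P x y"
  shows "P x y"
  using assms(1,2)
proof (induction "syl (inv x \<otimes> y)" arbitrary: x rule: less_induct)
  case less
  show ?case
  proof (cases "x = y")
    case True then show ?thesis using refl less.prems by simp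
  next
    case False
    then have "inv x \<otimes> y \<noteq> \<one>" using less.prems by (metis inv_closed inv_equality inv_inv)
    then obtain w t k where k: "w \<in> V" "t \<in> carrier (G w)" "k \<in> carrier W"
      "inv x \<otimes> y = \<iota> w t \<otimes> k" "syl (inv x \<otimes> y) = Suc (syl k)"
      using peel less.prems by (metis inv_closed m_closed)
    have "inv (x \<otimes> \<iota> w t) \<otimes> y = inv (\<iota> w t) \<otimes> (inv x \<otimes> y)"
      using k(1-3) less.prems by (simp add: inv_mult_group m_assoc)
    also have "\<dots> = k" unfolding k(4) using k(1-3) by (simp add: m_assoc[symmetric])
    finally have eq: "inv (x \<otimes> \<iota> w t) \<otimes> y = k" .
    show ?thesis
      by (rule step[OF less.prems k(3,1,2,4) eq k(5)], rule less.hyps) (use eq k less.prems in auto)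
  qed
qed

lemma card_separating:
  assumes "x \<in> carrier W" "y \<in> carrier W"
  shows "finite (separating x y) \<and> card (separating x y) = syl (inv x \<otimes> y)"
  using assms
proof (induction rule: path_induct)
  case (step x y k w t)
  then show ?case
    using separating_peel(1,2)[OF step(1-6,8)] by simp
qed simp

text \<open>The cross for two hyperplanes of the same label: \<open>\<alpha>\<close> and
  \<open>\<beta>\<close> are the values at two mutually closest base points. A point that leaves the
  value \<open>\<alpha>\<close> lies beyond the first hyperplane, and from the second one it is seen
  through the bridge between them.\<close>

lemma coord_dichotomy:
  assumes u: "u \<in> V" and "g \<in> carrier W" "h \<in> carrier W" and ne: "coord g u \<noteq> coord h u"
  obtains \<alpha> \<beta> where "\<And>x. x \<in> carrier W \<Longrightarrow> coord g u x = \<alpha> \<or> coord h u x = \<beta>"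
proof -
  \<comment> \<open>Both base points vary within their hyperplanes; minimality removes syllables
    from the star of \<open>u\<close> at either end of the bridge
    \<open>inv g' \<otimes> h'\<close>.\<close>
  let ?P = "\<lambda>(g', h'). g' \<in> carrier W \<and> h' \<in> carrier W \<and> coord g' u = coord g u \<and> coord h' u = coord h u"
  let ?m = "\<lambda>(g', h'). syl (inv g' \<otimes> h')"
  obtain a where a: "?P a" "\<And>b. ?P b \<Longrightarrow> ?m a \<le> ?m b"
    using ex_has_least_nat[of ?P "(g, h)" ?m] assms by auto
  obtain g' h' where gh': "a = (g', h')" by fastforce
  have P: "g' \<in> carrier W" "h' \<in> carrier W" "coord g' u = coord g u" "coord h' u = coord h u"
    using a(1) gh' by auto
  have min: "\<not> syl (inv g1 \<otimes> h1) < syl (inv g' \<otimes> h')" if "?P (g1, h1)" for g1 h1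
    using a(2)[OF that] gh' by simp
  have "g' \<noteq> h'" using P ne by auto
  have heads: "w \<noteq> u \<and> \<not> adj u w" if w: "w \<in> V" "p w (inv g' \<otimes> h') \<noteq> \<one>\<^bsub>G w\<^esub>" for w
  proof (rule ccontr)
    let ?b = "p w (inv g' \<otimes> h')"
    assume "\<not> (w \<noteq> u \<and> \<not> adj u w)"
    then have "?P (g' \<otimes> \<iota> w ?b, h')" using coord_shift P w u by auto
    moreover have "inv (g' \<otimes> \<iota> w ?b) \<otimes> h' = inv (\<iota> w ?b) \<otimes> (inv g' \<otimes> h')"
      using P w by (simp add: inv_mult_group m_assoc)
    ultimately show False using min[of "g' \<otimes> \<iota> w ?b" h'] syl_head[of w "inv g' \<otimes> h'"] w P by simp
  qed
  \<comment> \<open>Peeling the inverse of the bridge isolates its last syllable, the form required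
    by \<open>p_inv_mult_last\<close>.\<close>
  have "inv h' \<otimes> g' \<noteq> \<one>" using P \<open>g' \<noteq> h'\<close> by (metis inv_closed inv_equality inv_inv)
  then obtain w t y where wty: "w \<in> V" "t \<in> carrier (G w)" "y \<in> carrier W"
    "inv h' \<otimes> g' = \<iota> w t \<otimes> y" "syl (inv h' \<otimes> g') = Suc (syl y)"
    using peel P by (metis inv_closed m_closed)
  let ?k = "inv g' \<otimes> h'"
  have kinv: "inv ?k = \<iota> w t \<otimes> y" using P wty by (simp add: inv_mult_group)
  have w: "w \<noteq> u \<and> \<not> adj u w"
  proof (rule ccontr)
    assume "\<not> (w \<noteq> u \<and> \<not> adj u w)"
    then have "?P (g', h' \<otimes> \<iota> w t)" using coord_shift P wty u by auto
    moreover have "inv (h' \<otimes> \<iota> w t) \<otimes> g' = inv (\<iota> w t) \<otimes> (inv h' \<otimes> g')"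
      using P wty(1-3) by (simp add: inv_mult_group m_assoc)
    moreover have "\<dots> = y" unfolding wty(4) using wty(1-3) by (simp add: m_assoc[symmetric])
    ultimately show False
      using min[of g' "h' \<otimes> \<iota> w t"] wty P syl_inv_mult[of "h' \<otimes> \<iota> w t" g'] syl_inv_mult[of h' g'] by simp
  qed
  have keq: "?k = inv y \<otimes> \<iota> w (inv\<^bsub>G w\<^esub> t)"
  proof -
    have "?k = inv (inv ?k)" using P by (intro inv_inv[symmetric]) simp
    also have "\<dots> = inv y \<otimes> \<iota> w (inv\<^bsub>G w\<^esub> t)"
      unfolding kinv using wty(1-3) by (simp add: inv_mult_group incl_inv)
    finally show ?thesis .
  qed
  \<comment> \<open>If \<open>inv g' \<otimes> x\<close> starts with a \<open>u\<close>-syllable, no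
    front syllable of the bridge can start it as well. Hence \<open>inv h' \<otimes> x\<close>
    starts with label \<open>w\<close>, which blocks \<open>u\<close>.\<close>
  have alt: "p u (inv g' \<otimes> x) = \<one>\<^bsub>G u\<^esub> \<or> p u (inv h' \<otimes> x) = \<one>\<^bsub>G u\<^esub>" if x: "x \<in> carrier W" for x
  proof (rule disjCI)
    assume "p u (inv h' \<otimes> x) \<noteq> \<one>\<^bsub>G u\<^esub>"
    show "p u (inv g' \<otimes> x) = \<one>\<^bsub>G u\<^esub>"
    proof (rule ccontr)
      assume nu: "p u (inv g' \<otimes> x) \<noteq> \<one>\<^bsub>G u\<^esub>"
      have "p w (inv (inv y \<otimes> \<iota> w (inv\<^bsub>G w\<^esub> t)) \<otimes> (inv g' \<otimes> x)) \<noteq> \<one>\<^bsub>G w\<^esub>"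
      proof (rule p_inv_mult_last)
        show "syl (inv y \<otimes> \<iota> w (inv\<^bsub>G w\<^esub> t)) = Suc (syl (inv y))"
          using keq wty syl_inv_mult[of g' h'] P by (simp add: syl_inv)
        show "p z (inv g' \<otimes> x) = \<one>\<^bsub>G z\<^esub>"
          if "z \<in> V" "p z (inv y \<otimes> \<iota> w (inv\<^bsub>G w\<^esub> t)) \<noteq> \<one>\<^bsub>G z\<^esub>" for z
          using p_nonadj[of u z "inv g' \<otimes> x"] heads[of z] that keq u nu P x by auto
      qed (use wty P x in auto)
      also have "inv (inv y \<otimes> \<iota> w (inv\<^bsub>G w\<^esub> t)) \<otimes> (inv g' \<otimes> x) = inv h' \<otimes> x"
        unfolding keq[symmetric] using P x by (simp add: inv_mult_group m_assoc) (simp add: m_assoc[symmetric])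
      finally have "p u (inv h' \<otimes> x) = \<one>\<^bsub>G u\<^esub>"
        using p_nonadj[of w u "inv h' \<otimes> x"] w wty u P x adj_sym[of w u] by auto
      then show False using \<open>p u (inv h' \<otimes> x) \<noteq> \<one>\<^bsub>G u\<^esub>\<close> by simp
    qed
  qed
  have "coord g' u x = inv\<^bsub>G u\<^esub> (p u (inv g')) \<or> coord h' u x = inv\<^bsub>G u\<^esub> (p u (inv h'))"
    if x: "x \<in> carrier W" for x
    using alt[OF x] x P(1,2) u by (auto simp: coord_def)
  then show thesis unfolding P(3,4) by (rule that)
qed

section \<open>Tripods and the realisation of medians\<close>

definition tripod :: "'w \<Rightarrow> 'w \<Rightarrow> 'w \<Rightarrow> ('v \<times> ('w \<Rightarrow> 'g)) set"
  where "tripod x y z = {(u, f) \<in> hyperplanes. f x \<noteq> f y \<and> f x \<noteq> f z \<and> f y \<noteq> f z}"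

text \<open>Pigeonhole: for two hyperplanes of equal label, two of the three points satisfy the same
  alternative of \<open>coord_dichotomy\<close>, so they agree in that coordinate and it is no
  tripod.\<close>

lemma card_tripod:
  assumes "finite V" "x \<in> carrier W" "y \<in> carrier W" "z \<in> carrier W"
  shows "finite (tripod x y z) \<and> card (tripod x y z) \<le> card V"
proof -
  have inj: "inj_on fst (tripod x y z)"
  proof (rule inj_onI, clarsimp)
    fix u f f' assume f: "(u, f) \<in> tripod x y z" and f': "(u, f') \<in> tripod x y z"
    obtain g h where gh: "u \<in> V" "g \<in> carrier W" "h \<in> carrier W" "f = coord g u" "f' = coord h u"
      using f f' by (auto simp: tripod_def hyperplanes_def)
    show "f = f'"
    proof (rule ccontr)
      assume "f \<noteq> f'"
      then obtain \<alpha> \<beta> where "\<And>x. x \<in> carrier W \<Longrightarrow> coord g u x = \<alpha> \<or> coord h u x = \<beta>"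
        using coord_dichotomy gh by metis
      then show False using f f' gh assms by (auto simp: tripod_def)
    qed
  qed
  have "fst ` tripod x y z \<subseteq> V" by (auto simp: tripod_def hyperplanes_def)
  then show ?thesis
    using inj assms(1) by (metis card_inj_on_le inj_on_finite)
qed

lemma median_realized:
  fixes \<mu> :: "'v \<Rightarrow> 'g \<Rightarrow> 'g \<Rightarrow> 'g \<Rightarrow> 'g"
  assumes closed: "\<And>u a b c. u \<in> V \<Longrightarrow> a \<in> carrier (G u) \<Longrightarrow> b \<in> carrier (G u) \<Longrightarrow>
      c \<in> carrier (G u) \<Longrightarrow> \<mu> u a b c \<in> carrier (G u)"
    and maj: "\<And>u a b. u \<in> V \<Longrightarrow> \<mu> u a a b = a \<and> \<mu> u a b a = a \<and> \<mu> u b a a = a"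
    and x: "x \<in> carrier W" and y: "y \<in> carrier W" and z: "z \<in> carrier W"
  shows "\<exists>m\<in>carrier W. \<forall>(u, f)\<in>hyperplanes. f m = \<mu> u (f x) (f y) (f z)"
proof -
  let ?F = "\<lambda>u f. \<mu> u (f x) (f y) (f z)"
  \<comment> \<open>Points part of the way from \<open>x\<close> to the median. By majority, a
    coordinate moved away from \<open>x\<close> must separate \<open>x\<close> from \<open>y\<close>
    or from \<open>z\<close>, which bounds the distance to \<open>x\<close>.\<close>
  let ?A = "\<lambda>m. m \<in> carrier W \<and> (\<forall>(u, f)\<in>hyperplanes. f m = f x \<or> f m = ?F u f)"
  have bound: "syl (inv x \<otimes> m) \<le> syl (inv x \<otimes> y) + syl (inv x \<otimes> z)" if m: "?A m" for m
  proof -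
    have "J \<in> separating x y \<union> separating x z" if J: "J \<in> separating x m" for J
    proof (rule ccontr)
      assume nJ: "J \<notin> separating x y \<union> separating x z"
      obtain u f where uf: "J = (u, f)" by fastforce
      then have f: "f x \<noteq> f m" "(u, f) \<in> hyperplanes" "f y = f x" "f z = f x"
        using J nJ by (auto simp: separating_def)
      then have "u \<in> V" by (auto simp: hyperplanes_def)
      then have "?F u f = f x" using maj[of u "f x" "f x"] f(3,4) by simp
      moreover have "f m = f x \<or> f m = ?F u f" using m f(2) by blast
      ultimately show False using f(1) by metis
    qed
    then have "card (separating x m) \<le> card (separating x y \<union> separating x z)"
      using card_separating[OF x y] card_separating[OF x z] by (intro card_mono subsetI) blast+
    also have "\<dots> \<le> card (separating x y) + card (separating x z)" by (rule card_Un_le)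
    finally show ?thesis
      using card_separating[OF x y] card_separating[OF x z] card_separating[of x m] x m by simp
  qed
  have Ax: "?A x" using x by blast
  have "\<exists>m. ?A m \<and> (\<forall>m'. ?A m' \<longrightarrow> syl (inv x \<otimes> m') \<le> syl (inv x \<otimes> m))"
  proof (rule ex_has_greatest_nat[where P = ?A and f = "\<lambda>m. syl (inv x \<otimes> m)", OF Ax])
    show "\<forall>m. ?A m \<longrightarrow> syl (inv x \<otimes> m) < Suc (syl (inv x \<otimes> y) + syl (inv x \<otimes> z))"
      using bound le_imp_less_Suc by blast
  qed
  then obtain m where m: "?A m"
    and max: "\<And>m'. ?A m' \<Longrightarrow> syl (inv x \<otimes> m') \<le> syl (inv x \<otimes> m)"
    by blast
  have mc: "m \<in> carrier W" using m by blast
  have Fc: "?F u f \<in> carrier (G u)" if "(u, f) \<in> hyperplanes" for u f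
  proof (rule closed)
    show "u \<in> V" using that by (auto simp: hyperplanes_def)
  qed (rule hyperplanes_closed[OF that], fact)+
  \<comment> \<open>A hyperplane based at \<open>m\<close> that misses its target still has the
    value of \<open>x\<close>. One edge corrects it, disturbs no other hyperplane and increases the
    distance to \<open>x\<close>, against maximality.\<close>
  have here: "coord m u m = ?F u (coord m u)" if u: "u \<in> V" for u
  proof (rule ccontr)
    assume ne: "coord m u m \<noteq> ?F u (coord m u)"
    interpret U: group "G u" using u vertex_group by blast
    have J: "(u, coord m u) \<in> hyperplanes" using u mc by (auto simp: hyperplanes_def)
    have e: "coord m u m \<in> carrier (G u)" using coord_closed u mc by blast
    obtain a where a: "a \<in> carrier (G u)" "a \<noteq> \<one>\<^bsub>G u\<^esub>" "coord m u m \<otimes>\<^bsub>G u\<^esub> a = ?F u (coord m u)"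
    proof (rule that[of "inv\<^bsub>G u\<^esub> (coord m u m) \<otimes>\<^bsub>G u\<^esub> ?F u (coord m u)"])
      show "inv\<^bsub>G u\<^esub> (coord m u m) \<otimes>\<^bsub>G u\<^esub> ?F u (coord m u) \<in> carrier (G u)"
        using Fc[OF J] e by blast
      show "inv\<^bsub>G u\<^esub> (coord m u m) \<otimes>\<^bsub>G u\<^esub> ?F u (coord m u) \<noteq> \<one>\<^bsub>G u\<^esub>"
        using ne e Fc[OF J] by (metis U.inv_closed U.inv_equality U.inv_inv)
      show "coord m u m \<otimes>\<^bsub>G u\<^esub> (inv\<^bsub>G u\<^esub> (coord m u m) \<otimes>\<^bsub>G u\<^esub> ?F u (coord m u)) = ?F u (coord m u)"
        using Fc[OF J] e by (simp add: U.m_assoc[symmetric] del: vertex_monoid_simps)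
    qed
    let ?m = "m \<otimes> \<iota> u a"
    have am: "coord m u ?m = ?F u (coord m u)"
      using coord_mult_incl[OF u mc a(1)] a(3) by simp
    have mc': "?m \<in> carrier W" using u mc a(1) by simp
    have "?A ?m"
    proof (intro conjI ballI mc', clarify)
      fix v f assume vf: "(v, f) \<in> hyperplanes" and n: "f ?m \<noteq> ?F v f"
      then have "(v, f) \<noteq> (u, coord m u)" using am by blast
      then have "(v, f) \<notin> separating m ?m" using separating_edge[OF u mc a(1)] by blast
      then have "f ?m = f m" using vf by (simp add: separating_def)
      moreover have "f m = f x \<or> f m = ?F v f" using m vf by blast
      ultimately show "f ?m = f x" using n by simp
    qed
    moreover have "coord m u m = coord m u x" using m J ne by blast
    then have "p u (inv m \<otimes> x) = \<one>\<^bsub>G u\<^esub>"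
      using coord_eq_iff[OF u mc mc x] u mc by simp
    then have "syl (\<iota> u (inv\<^bsub>G u\<^esub> a) \<otimes> (inv m \<otimes> x)) = Suc (syl (inv m \<otimes> x))"
      using a(1,2) u mc x by (intro syl_incl_mult_Suc) simp_all
    then have "syl (inv ?m \<otimes> x) = Suc (syl (inv m \<otimes> x))"
      using a(1) u mc x by (simp add: incl_inv inv_mult_group m_assoc)
    ultimately show False
      using max[of ?m] syl_inv_mult[OF x mc'] syl_inv_mult[OF x mc] by simp
  qed
  \<comment> \<open>Induction on the distance from the base point to \<open>m\<close>. The step
    towards \<open>m\<close> with label \<open>w\<close> keeps the hyperplanes in the star of
    \<open>w\<close>; the other ones form a cross with the hyperplane being crossed.\<close>
  have all: "coord g u m = ?F u (coord g u)" if "g \<in> carrier W" "u \<in> V" for g u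
    using that
  proof (induction "syl (inv g \<otimes> m)" arbitrary: g u rule: less_induct)
    case less
    note g = less.prems(1) and u = less.prems(2)
    show ?case
    proof (cases "inv g \<otimes> m = \<one>")
      case True
      then have "g = m" using g mc by (metis inv_closed inv_equality inv_inv)
      then show ?thesis using here u by simp
    next
      case False
      then obtain w t k where k: "w \<in> V" "t \<in> carrier (G w)" "k \<in> carrier W"
        "inv g \<otimes> m = \<iota> w t \<otimes> k" "syl (inv g \<otimes> m) = Suc (syl k)"
        using peel g mc by (metis inv_closed m_closed)
      let ?g = "g \<otimes> \<iota> w t"
      have "inv ?g \<otimes> m = inv (\<iota> w t) \<otimes> (inv g \<otimes> m)"
        using k(1-3) g mc by (simp add: inv_mult_group m_assoc)
      also have "\<dots> = k" unfolding k(4) using k(1-3) by (simp add: m_assoc[symmetric])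
      finally have shorter: "syl (inv ?g \<otimes> m) < syl (inv g \<otimes> m)" using k by simp
      have ih: "coord g v m = ?F v (coord g v)" if "v \<in> V" "w = v \<or> adj v w" for v
        using less.hyps[OF shorter, of v] coord_shift[of v w t g] that k g by simp
      show ?thesis
      proof (cases "w = u \<or> adj u w")
        case True then show ?thesis using ih u by blast
      next
        case False
        have t: "p w (inv g \<otimes> m) \<noteq> \<one>\<^bsub>G w\<^esub>"
          using p_of_syl_Suc(2,3)[of w t k] k by simp
        have excl: "p w (inv g \<otimes> q) = \<one>\<^bsub>G w\<^esub> \<or> p u (inv g \<otimes> q) = \<one>\<^bsub>G u\<^esub>" if "q \<in> carrier W" for q
          using p_nonadj[of w u "inv g \<otimes> q"] False adj_sym[of w u] k u g that by auto
        have cg: "coord g v q = coord g v g \<longleftrightarrow> p v (inv g \<otimes> q) = \<one>\<^bsub>G v\<^esub>"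
          if "q \<in> carrier W" "v \<in> V" for q v
          using coord_eq_iff[of v g q g] that g by simp
        have excl': "coord g w q = coord g w g \<or> coord g u q = coord g u g" if "q \<in> carrier W" for q
          using excl[OF that] cg[OF that] u k by blast
        \<comment> \<open>If two of \<open>x\<close>, \<open>y\<close>, \<open>z\<close> had the
          \<open>w\<close>-value of \<open>g\<close>, majority would return it. So by the cross at
          least two of them have the \<open>u\<close>-value of \<open>g\<close>, and majority makes
          this the target.\<close>
        have "?F w (coord g w) \<noteq> coord g w g"
          using ih[of w] t cg[of m w] mc k by auto
        then have "?F u (coord g u) = coord g u g"
          using excl'[OF x] excl'[OF y] excl'[OF z] maj[OF k(1)] maj[OF u]
          by (elim disjE) simp_all
        moreover have "coord g u m = coord g u g"
          using excl[OF mc] t cg[OF mc u] by blast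
        ultimately show ?thesis by simp
      qed
    qed
  qed
  show ?thesis
  proof (intro bexI[of _ m] ballI mc, clarify)
    fix u f assume "(u, f) \<in> hyperplanes"
    then show "f m = ?F u f" using all by (auto simp: hyperplanes_def)
  qed
qed

end

section \<open>Coordinatewise medians\<close>

locale median_projections = head_projections W V adj G \<iota> p
  for W :: "('w, 'n) monoid_scheme" (structure)
    and V :: "'v set" and adj and G :: "'v \<Rightarrow> ('g, 'm) monoid_scheme" and \<iota> and p +
  fixes S :: "'v \<Rightarrow> 'g set" and \<mu> :: "'v \<Rightarrow> 'g \<Rightarrow> 'g \<Rightarrow> 'g \<Rightarrow> 'g" and \<kappa> :: real
  assumes finite_vertices: "finite V"
    and \<kappa>_nonneg: "0 \<le> \<kappa>"
    and vertex_word_metric: "u \<in> V \<Longrightarrow> word_metric (G u) (S u)"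
    and vertex_median: "u \<in> V \<Longrightarrow>
      strict_coarse_median (carrier (G u)) (word_dist (G u) (S u)) \<kappa> (\<mu> u)"
begin

definition gens :: "'w set"
  where "gens = (\<Union>u\<in>V. \<iota> u ` S u)"

lemma gens_closed: "u \<in> V \<Longrightarrow> S u \<subseteq> carrier (G u)"
  using vertex_word_metric word_metric.gens_sub by blast

lemma incl_generate:
  assumes "u \<in> V" "a \<in> carrier (G u)"
  shows "\<iota> u a \<in> generate W gens"
proof -
  have "a \<in> generate (G u) (S u)"
    using assms word_metric.gens_generate vertex_word_metric by blast
  then show ?thesis
  proof induction
    case one then show ?case using assms generate.one by simp
  next
    case (incl h) then show ?case using assms by (auto simp: gens_def intro: generate.incl)
  next
    case (inv h)
    then have "\<iota> u (inv\<^bsub>G u\<^esub> h) = inv (\<iota> u h)" using assms gens_closed by (intro incl_inv) auto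
    then show ?case using assms inv by (auto simp: gens_def intro: generate.inv)
  next
    case (eng h1 h2)
    interpret U: group "G u" using assms vertex_group by blast
    have "h1 \<in> carrier (G u)" "h2 \<in> carrier (G u)"
      using eng.hyps U.generate_incl[OF gens_closed[OF assms(1)]] by auto
    then show ?case using eng.IH assms by (auto simp: incl_mult intro: generate.eng)
  qed
qed

sublocale word_metric W gens
proof
  show sub: "gens \<subseteq> carrier W" by (auto simp: gens_def intro!: incl_closed subsetD[OF gens_closed])
  show "generate W gens = carrier W"
  proof
    show "generate W gens \<subseteq> carrier W" using generate_incl[OF sub] .
    show "carrier W \<subseteq> generate W gens"
    proof
      fix x assume "x \<in> carrier W"
      then obtain w where w: "w \<in> fp_words V G" "val w = x" using val_exists by blast
      have "w \<in> fp_words V G \<Longrightarrow> val w \<in> generate W gens" for w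
        by (induction w rule: val.induct) (auto intro: generate.one generate.eng incl_generate)
      then show "x \<in> generate W gens" using w by blast
    qed
  qed
qed

lemma word_length_incl:
  assumes u: "u \<in> V" "a \<in> carrier (G u)"
  shows "word_length W gens (\<iota> u a) \<le> word_length (G u) (S u) a"
proof -
  interpret U: word_metric "G u" "S u" using assms vertex_word_metric by blast
  obtain ws where ws: "length ws = word_length (G u) (S u) a" "set ws \<subseteq> U.letters"
    "foldr (\<otimes>\<^bsub>G u\<^esub>) ws \<one>\<^bsub>G u\<^esub> = a"
    using U.word_length_attained[OF u(2)] by blast
  have "set (map (\<iota> u) ws) \<subseteq> letters"
  proof
    fix x assume "x \<in> set (map (\<iota> u) ws)"
    then obtain s where s: "x = \<iota> u s" "s \<in> U.letters" using ws(2) by auto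
    have sub: "\<iota> u ` S u \<subseteq> gens" using u(1) by (auto simp: gens_def)
    from s(2) consider "s \<in> S u" | t where "t \<in> S u" "s = inv\<^bsub>G u\<^esub> t" by blast
    then show "x \<in> letters"
    proof cases
      case 1
      then show ?thesis using s(1) sub by blast
    next
      case 2
      then have "x = inv (\<iota> u t)"
        using s(1) incl_inv[OF u(1)] subsetD[OF gens_closed[OF u(1)]] by simp
      then show ?thesis using 2(1) sub by blast
    qed
  qed
  moreover have "set ws \<subseteq> carrier (G u) \<Longrightarrow>
      foldr (\<otimes>) (map (\<iota> u) ws) \<one> = \<iota> u (foldr (\<otimes>\<^bsub>G u\<^esub>) ws \<one>\<^bsub>G u\<^esub>)" for ws
    using u(1) by (induction ws) (auto simp: incl_mult U.foldr_mult_closed)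
  then have "foldr (\<otimes>) (map (\<iota> u) ws) \<one> = \<iota> u a"
    using ws(2,3) U.letters_sub by blast
  ultimately show ?thesis
    using word_length_le[of "map (\<iota> u) ws"] ws(1) by simp
qed

section \<open>Word distance bounded by coordinate distances\<close>

definition coord_dist :: "'w \<Rightarrow> 'w \<Rightarrow> 'v \<times> ('w \<Rightarrow> 'g) \<Rightarrow> real"
  where "coord_dist x y = (\<lambda>(u, f). word_dist (G u) (S u) (f x) (f y))"

text \<open>Follow a geodesic of syllables. Each syllable costs at most the distance in the one
  coordinate it changes, and the coordinates still to be crossed are unaffected by it.\<close>

lemma word_dist_le_sum:
  assumes "x \<in> carrier W" "y \<in> carrier W"
  shows "word_dist W gens x y \<le> sum (coord_dist x y) (separating x y)"
  using assms
proof (induction rule: path_induct)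
  case (refl x)
  then show ?case by (simp add: word_dist_self)
next
  case (step x y k w t)
  let ?x = "x \<otimes> \<iota> w t" and ?J = "(w, coord x w)"
  interpret U: word_metric "G w" "S w" using step vertex_word_metric by blast
  note peel = separating_peel[OF step(1-6,8)]
  have xc: "?x \<in> carrier W" using step by simp
  have fin: "finite (separating ?x y)" using card_separating[OF xc step(2)] by blast
  have "word_dist W gens x ?x \<le> real (word_length (G w) (S w) t)"
    using word_dist_mult_right[of x "\<iota> w t"] word_length_incl[of w t] step(1,4,5) by simp
  also have "\<dots> = coord_dist x y ?J"
    unfolding coord_dist_def prod.case peel(4)
    using U.word_dist_mult_right[of "coord x w x" t] coord_closed[OF step(4,1,1)] step(5) by simp
  finally have 1: "word_dist W gens x ?x \<le> coord_dist x y ?J" .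
  have "coord_dist ?x y J = coord_dist x y J" if J: "J \<in> separating ?x y" for J
  proof -
    have "J \<notin> separating x ?x" using J peel(2) separating_edge[OF step(4,1,5)] by blast
    then show ?thesis using J by (auto simp: coord_dist_def separating_def)
  qed
  then have 2: "sum (coord_dist ?x y) (separating ?x y) = sum (coord_dist x y) (separating ?x y)"
    by (intro sum.cong) auto
  have "word_dist W gens x y \<le> word_dist W gens x ?x + word_dist W gens ?x y"
    using step xc by (intro word_dist_triangle)
  also have "\<dots> \<le> coord_dist x y ?J + sum (coord_dist x y) (separating ?x y)"
    using 1 2 step.IH by simp
  also have "\<dots> = sum (coord_dist x y) (separating x y)"
    unfolding peel(1) using fin peel(2) by simp
  finally show ?case .
qed

lemma word_dist_le_card:
  assumes "x \<in> carrier W" "y \<in> carrier W" "0 \<le> c"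
    and "separating x y \<subseteq> B" "finite B" "real (card B) \<le> n"
    and "\<And>u f. (u, f) \<in> separating x y \<Longrightarrow> word_dist (G u) (S u) (f x) (f y) \<le> c"
  shows "word_dist W gens x y \<le> n * c"
proof -
  have "sum (coord_dist x y) (separating x y) \<le> real (card (separating x y)) * c"
    using assms(7) by (intro sum_bounded_above) (auto simp: coord_dist_def)
  also have "\<dots> \<le> real (card B) * c"
    using assms(3-5) by (intro mult_right_mono) (auto intro: card_mono)
  also have "\<dots> \<le> n * c"
    using assms(3,6) by (intro mult_right_mono)
  finally show ?thesis using word_dist_le_sum[OF assms(1,2)] by linarith
qed

section \<open>The median of the graph product and its axioms\<close>

definition median :: "'w \<Rightarrow> 'w \<Rightarrow> 'w \<Rightarrow> 'w"
  where "median x y z =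
    (SOME m. m \<in> carrier W \<and> (\<forall>(u, f)\<in>hyperplanes. f m = \<mu> u (f x) (f y) (f z)))"

lemma vertex_median_majority: "u \<in> V \<Longrightarrow> \<mu> u a a b = a \<and> \<mu> u a b a = a \<and> \<mu> u b a a = a"
  using vertex_median unfolding strict_coarse_median_def by blast

lemma vertex_median_closed:
  "u \<in> V \<Longrightarrow> a \<in> carrier (G u) \<Longrightarrow> b \<in> carrier (G u) \<Longrightarrow> c \<in> carrier (G u) \<Longrightarrow>
    \<mu> u a b c \<in> carrier (G u)"
  using vertex_median unfolding strict_coarse_median_def by blast

lemma median_spec:
  assumes "x \<in> carrier W" "y \<in> carrier W" "z \<in> carrier W"
  shows "median x y z \<in> carrier W"
    and "(u, f) \<in> hyperplanes \<Longrightarrow> f (median x y z) = \<mu> u (f x) (f y) (f z)"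
proof -
  have "\<exists>m\<in>carrier W. \<forall>(u, f)\<in>hyperplanes. f m = \<mu> u (f x) (f y) (f z)"
    using vertex_median_closed vertex_median_majority assms by (rule median_realized)
  then have "\<exists>m. m \<in> carrier W \<and> (\<forall>(u, f)\<in>hyperplanes. f m = \<mu> u (f x) (f y) (f z))"
    by blast
  from someI_ex[OF this, folded median_def]
  show "median x y z \<in> carrier W"
    and "(u, f) \<in> hyperplanes \<Longrightarrow> f (median x y z) = \<mu> u (f x) (f y) (f z)"
    by blast+
qed

lemma hyperplane_label: "(u, f) \<in> hyperplanes \<Longrightarrow> u \<in> V"
  by (auto simp: hyperplanes_def)

lemma vertex_median_permute:
  assumes "u \<in> V" "x = y \<or> x = z \<or> y = z"
  shows "\<mu> u x z y = \<mu> u x y z" "\<mu> u y x z = \<mu> u x y z" "\<mu> u y z x = \<mu> u x y z"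
    "\<mu> u z x y = \<mu> u x y z" "\<mu> u z y x = \<mu> u x y z"
  using assms(2) by (elim disjE; simp add: vertex_median_majority[OF assms(1)])+

lemma median_diagonal:
  assumes "a \<in> carrier W" "b \<in> carrier W"
  shows "word_dist W gens (median a a b) a \<le> 0"
proof -
  have "separating (median a a b) a = {}"
    using median_spec(2)[OF assms(1,1,2)] vertex_median_majority hyperplane_label
    by (auto simp: separating_def)
  then show ?thesis
    using word_dist_le_sum[OF median_spec(1)[OF assms(1,1,2)] assms(1)] by simp
qed

text \<open>With a repeated value the vertex medians are exactly symmetric, so only tripods
  contribute, at most one per label and each at most \<open>\<kappa>\<close>.\<close>

lemma median_permute:
  fixes a :: "nat \<Rightarrow> 'w"
  assumes a: "\<forall>i\<in>{1,2,3}. a i \<in> carrier W" and \<sigma>: "\<sigma> permutes {1,2,3}"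
  shows "word_dist W gens (median (a (\<sigma> 1)) (a (\<sigma> 2)) (a (\<sigma> 3))) (median (a 1) (a 2) (a 3))
    \<le> real (card V) * \<kappa>"
proof -
  have \<sigma>in: "\<sigma> i \<in> {1,2,3}" if "i \<in> {1,2,3}" for i
    using permutes_in_image[OF \<sigma>] that by blast
  have \<sigma>ne: "\<sigma> 1 \<noteq> \<sigma> 2" "\<sigma> 1 \<noteq> \<sigma> 3" "\<sigma> 2 \<noteq> \<sigma> 3"
    by (simp_all add: inj_eq[OF permutes_inj[OF \<sigma>]])
  have c: "a 1 \<in> carrier W" "a 2 \<in> carrier W" "a 3 \<in> carrier W" using a by auto
  have c\<sigma>: "a (\<sigma> 1) \<in> carrier W" "a (\<sigma> 2) \<in> carrier W" "a (\<sigma> 3) \<in> carrier W"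
    using a \<sigma>in by blast+
  note coords = median_spec(2)[OF c] median_spec(2)[OF c\<sigma>]
  show ?thesis
  proof (rule word_dist_le_card)
    show "separating (median (a (\<sigma> 1)) (a (\<sigma> 2)) (a (\<sigma> 3))) (median (a 1) (a 2) (a 3))
        \<subseteq> tripod (a 1) (a 2) (a 3)"
    proof (rule ccontr)
      assume "\<not> ?thesis"
      then obtain u f where
        "(u, f) \<in> separating (median (a (\<sigma> 1)) (a (\<sigma> 2)) (a (\<sigma> 3))) (median (a 1) (a 2) (a 3))"
        "(u, f) \<notin> tripod (a 1) (a 2) (a 3)"
        by auto
      then have h: "(u, f) \<in> hyperplanes"
        and ne: "f (median (a (\<sigma> 1)) (a (\<sigma> 2)) (a (\<sigma> 3))) \<noteq> f (median (a 1) (a 2) (a 3))"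
        and eq: "f (a 1) = f (a 2) \<or> f (a 1) = f (a 3) \<or> f (a 2) = f (a 3)"
        by (auto simp: separating_def tripod_def)
      have "\<sigma> 1 = 1 \<or> \<sigma> 1 = 2 \<or> \<sigma> 1 = 3" "\<sigma> 2 = 1 \<or> \<sigma> 2 = 2 \<or> \<sigma> 2 = 3"
        "\<sigma> 3 = 1 \<or> \<sigma> 3 = 2 \<or> \<sigma> 3 = 3"
        using \<sigma>in by auto
      then have "(\<sigma> 1 = 1 \<and> \<sigma> 2 = 2 \<and> \<sigma> 3 = 3) \<or>
          (\<sigma> 1 = 1 \<and> \<sigma> 2 = 3 \<and> \<sigma> 3 = 2) \<or>
          (\<sigma> 1 = 2 \<and> \<sigma> 2 = 1 \<and> \<sigma> 3 = 3) \<or>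
          (\<sigma> 1 = 2 \<and> \<sigma> 2 = 3 \<and> \<sigma> 3 = 1) \<or>
          (\<sigma> 1 = 3 \<and> \<sigma> 2 = 1 \<and> \<sigma> 3 = 2) \<or>
          (\<sigma> 1 = 3 \<and> \<sigma> 2 = 2 \<and> \<sigma> 3 = 1)"
        using \<sigma>ne by (elim disjE) simp_all
      then show False
        using ne[unfolded coords[OF h]] vertex_median_permute[OF hyperplane_label[OF h] eq]
        by (elim disjE) simp_all
    qed
    show "word_dist (G u) (S u) (f (median (a (\<sigma> 1)) (a (\<sigma> 2)) (a (\<sigma> 3)))) (f (median (a 1) (a 2) (a 3)))
        \<le> \<kappa>" if "(u, f) \<in> separating (median (a (\<sigma> 1)) (a (\<sigma> 2)) (a (\<sigma> 3))) (median (a 1) (a 2) (a 3))" for u f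
    proof -
      have f: "(u, f) \<in> hyperplanes" using that by (simp add: separating_def)
      have perm: "\<forall>a :: nat \<Rightarrow> 'g. (\<forall>i\<in>{1,2,3}. a i \<in> carrier (G u)) \<longrightarrow> (\<forall>\<sigma>. \<sigma> permutes {1,2,3} \<longrightarrow>
          word_dist (G u) (S u) (\<mu> u (a (\<sigma> 1)) (a (\<sigma> 2)) (a (\<sigma> 3))) (\<mu> u (a 1) (a 2) (a 3)) \<le> \<kappa>)"
        using vertex_median[OF hyperplane_label[OF f]] unfolding strict_coarse_median_def by (elim conjE)
      have "\<forall>i\<in>{1,2,3}. f (a i) \<in> carrier (G u)" using a hyperplanes_closed[OF f] by blast
      then show ?thesis
        unfolding coords[OF f] using perm[THEN spec, of "\<lambda>i. f (a i)"] \<sigma> by simp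
    qed
  qed (use median_spec(1) c c\<sigma> card_tripod[OF finite_vertices] \<kappa>_nonneg in auto)
qed

text \<open>A generator changes one coordinate by at most 1, hence the median by at most
  \<open>\<kappa> * 1 + \<kappa>\<close>. The additive constant is paid per generator and so becomes
  part of the slope.\<close>

lemma median_lipschitz:
  assumes "b \<in> carrier W" "c \<in> carrier W" "a \<in> carrier W" "a' \<in> carrier W"
  shows "word_dist W gens (median a b c) (median a' b c) \<le> (2 * \<kappa>) * word_dist W gens a a'"
proof (rule word_dist_lipschitz[of "\<lambda>x. median x b c"])
  show "median x b c \<in> carrier W" if "x \<in> carrier W" for x
    using median_spec(1) that assms by blast
  fix x s assume x: "x \<in> carrier W" and "s \<in> letters"
  then obtain u t where t: "u \<in> V" "t \<in> S u" "s = \<iota> u t \<or> s = inv (\<iota> u t)"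
    by (auto simp: gens_def)
  interpret U: word_metric "G u" "S u" using t vertex_word_metric by blast
  have tc: "t \<in> carrier (G u)" using t(1,2) gens_closed by blast
  obtain r where r: "r \<in> U.letters" "r \<in> carrier (G u)" "s = \<iota> u r"
  proof (cases "s = \<iota> u t")
    case True
    then show thesis using that[of t] t tc by blast
  next
    case False
    then have "s = \<iota> u (inv\<^bsub>G u\<^esub> t)" using t(1,3) tc by (simp add: incl_inv)
    then show thesis using that[of "inv\<^bsub>G u\<^esub> t"] t(2) tc by blast
  qed
  have xs: "x \<otimes> s \<in> carrier W" using x r t by simp
  note coords = median_spec(2)[OF x assms(1,2)] median_spec(2)[OF xs assms(1,2)]
  have "word_dist W gens (median x b c) (median (x \<otimes> s) b c) \<le> 1 * (2 * \<kappa>)"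
  proof (rule word_dist_le_card)
    have "separating (median x b c) (median (x \<otimes> s) b c) \<subseteq> separating x (x \<otimes> s)"
      by (auto simp: separating_def coords)
    also have "\<dots> \<subseteq> {(u, coord x u)}" using separating_edge t(1) x r(2,3) by blast
    finally show sub: "separating (median x b c) (median (x \<otimes> s) b c) \<subseteq> {(u, coord x u)}" .
    fix v f assume vf: "(v, f) \<in> separating (median x b c) (median (x \<otimes> s) b c)"
    then have f: "v = u" "f = coord x u" "(u, f) \<in> hyperplanes"
      using sub by (auto simp: separating_def)
    have "word_dist (G u) (S u) (f x) (f (x \<otimes> s)) = real (word_length (G u) (S u) r)"
      using f(2) r(2,3) coord_mult_incl[OF t(1) x] coord_closed[OF t(1) x x]
      by (simp add: U.word_dist_mult_right)
    then have 1: "word_dist (G u) (S u) (f x) (f (x \<otimes> s)) \<le> 1"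
      using U.word_length_letter[OF r(1)] by simp
    have "word_dist (G u) (S u) (\<mu> u (f x) (f b) (f c)) (\<mu> u (f (x \<otimes> s)) (f b) (f c))
        \<le> \<kappa> * word_dist (G u) (S u) (f x) (f (x \<otimes> s)) + \<kappa>"
      using vertex_median[OF t(1)] hyperplanes_closed[OF f(3)] x xs assms
      unfolding strict_coarse_median_def by blast
    also have "\<dots> \<le> \<kappa> * 1 + \<kappa>"
      using 1 \<kappa>_nonneg by (intro add_right_mono mult_left_mono)
    finally show "word_dist (G v) (S v) (f (median x b c)) (f (median (x \<otimes> s) b c)) \<le> 2 * \<kappa>"
      using f by (simp add: coords)
  qed (use median_spec(1) x xs assms \<kappa>_nonneg in auto)
  then show "word_dist W gens (median x b c) (median (x \<otimes> s) b c) \<le> 2 * \<kappa>" by simp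
qed (use assms in auto)

text \<open>If none of the four triples from \<open>a\<close>, \<open>b\<close>, \<open>c\<close>,
  \<open>e\<close> has three distinct values, at most two values occur, and majority satisfies the
  identity exactly. Each triple accounts for at most \<open>card V\<close> tripods, whence the
  factor 4.\<close>

lemma median_five_points:
  assumes "a \<in> carrier W" "b \<in> carrier W" "c \<in> carrier W" "e \<in> carrier W"
  shows "word_dist W gens (median (median a b c) b e) (median a b (median c b e))
    \<le> (4 * real (card V)) * \<kappa>"
proof (rule word_dist_le_card)
  let ?T = "(tripod a b c \<union> tripod a b e) \<union> (tripod a c e \<union> tripod b c e)"
  have abc: "median a b c \<in> carrier W" and cbe: "median c b e \<in> carrier W"
    using median_spec(1) assms by blast+
  then show c: "median (median a b c) b e \<in> carrier W" "median a b (median c b e) \<in> carrier W"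
    using median_spec(1) assms by blast+
  note coords = median_spec(2)[OF assms(1-3)] median_spec(2)[OF assms(3,2,4)]
    median_spec(2)[OF abc assms(2,4)] median_spec(2)[OF assms(1,2) cbe]
  note tri = card_tripod[OF finite_vertices]
  show "finite ?T" using tri assms by blast
  have "card ?T \<le> (card (tripod a b c) + card (tripod a b e)) + (card (tripod a c e) + card (tripod b c e))"
    by (intro order_trans[OF card_Un_le] add_mono card_Un_le)
  also have "\<dots> \<le> (card V + card V) + (card V + card V)"
    using tri assms by (intro add_mono) auto
  finally show "real (card ?T) \<le> 4 * real (card V)" by simp
  show "separating (median (median a b c) b e) (median a b (median c b e)) \<subseteq> ?T"
  proof (rule ccontr)
    assume "\<not> ?thesis"
    then obtain u f where uf: "(u, f) \<in> separating (median (median a b c) b e) (median a b (median c b e))"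
      "(u, f) \<notin> ?T"
      by auto
    then have f: "(u, f) \<in> hyperplanes"
      "\<mu> u (\<mu> u (f a) (f b) (f c)) (f b) (f e) \<noteq> \<mu> u (f a) (f b) (\<mu> u (f c) (f b) (f e))"
      "(u, f) \<notin> ?T"
      by (auto simp: separating_def coords)
    have "f a = f b \<or> f a = f c \<or> f b = f c" "f a = f b \<or> f a = f e \<or> f b = f e"
      "f a = f c \<or> f a = f e \<or> f c = f e" "f b = f c \<or> f b = f e \<or> f c = f e"
      using f(1,3) by (auto simp: tripod_def)
    then show False
      using f(2) vertex_median_majority[OF hyperplane_label[OF f(1)]] by metis
  qed
  show "word_dist (G u) (S u) (f (median (median a b c) b e)) (f (median a b (median c b e))) \<le> \<kappa>"
    if "(u, f) \<in> separating (median (median a b c) b e) (median a b (median c b e))" for u f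
  proof -
    have f: "(u, f) \<in> hyperplanes" using that by (simp add: separating_def)
    have five: "\<forall>a\<in>carrier (G u). \<forall>b\<in>carrier (G u). \<forall>c\<in>carrier (G u). \<forall>e\<in>carrier (G u).
        word_dist (G u) (S u) (\<mu> u (\<mu> u a b c) b e) (\<mu> u a b (\<mu> u c b e)) \<le> \<kappa>"
      using vertex_median[OF hyperplane_label[OF f]] unfolding strict_coarse_median_def by (elim conjE)
    show ?thesis
      unfolding coords[OF f] using five hyperplanes_closed[OF f] assms by blast
  qed
qed (use \<kappa>_nonneg in simp)

lemma coarse_median_median: "coarse_median (carrier W) (word_dist W gens) median"
proof -
  \<comment> \<open>The summand \<open>4 * real (card V)\<close> serves (C0) and (C2), the summand 2
    the slope in (C1).\<close>
  let ?k = "(4 * real (card V) + 2) * \<kappa>"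
  have k: "0 \<le> ?k" "real (card V) * \<kappa> \<le> ?k" "(4 * real (card V)) * \<kappa> \<le> ?k" "2 * \<kappa> \<le> ?k"
    using \<kappa>_nonneg by (auto intro!: mult_right_mono)
  have C1: "word_dist W gens (median a b c) (median a' b c) \<le> ?k * word_dist W gens a a' + ?k"
    if "a \<in> carrier W" "a' \<in> carrier W" "b \<in> carrier W" "c \<in> carrier W" for a a' b c
  proof -
    have "(2 * \<kappa>) * word_dist W gens a a' \<le> ?k * word_dist W gens a a'"
      using k(4) by (rule mult_right_mono) (rule word_dist_nonneg)
    then show ?thesis using median_lipschitz[OF that(3,4,1,2)] k(1) by linarith
  qed
  have C0: "word_dist W gens (median (a 1) (a 1) (a 2)) (a 1) \<le> ?k \<and>
      word_dist W gens (median (a (\<sigma> 1)) (a (\<sigma> 2)) (a (\<sigma> 3))) (median (a 1) (a 2) (a 3)) \<le> ?k"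
    if "\<forall>i\<in>{1,2,3}. a i \<in> carrier W" "\<sigma> permutes {1,2,3}" for a :: "nat \<Rightarrow> 'w" and \<sigma>
    using median_diagonal[of "a 1" "a 2"] median_permute[OF that] that(1) k by auto
  have C2: "word_dist W gens (median (median a b c) b e) (median a b (median c b e)) \<le> ?k"
    if "a \<in> carrier W" "b \<in> carrier W" "c \<in> carrier W" "e \<in> carrier W" for a b c e
    using median_five_points[OF that] k(3) by linarith
  show ?thesis
    unfolding coarse_median_def
  proof (intro conjI exI[of _ ?k] k(1) ballI)
    show "\<forall>a :: nat \<Rightarrow> 'w. (\<forall>i\<in>{1,2,3}. a i \<in> carrier W) \<longrightarrow> (\<forall>\<sigma>. \<sigma> permutes {1,2,3} \<longrightarrow>
        word_dist W gens (median (a 1) (a 1) (a 2)) (a 1) \<le> ?k \<and>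
        word_dist W gens (median (a (\<sigma> 1)) (a (\<sigma> 2)) (a (\<sigma> 3))) (median (a 1) (a 2) (a 3)) \<le> ?k)"
      using C0 by blast
  qed (fact median_spec(1) C1 C2)+
qed

lemma coarse_median_group_if_finite_gens:
  assumes "\<And>u. u \<in> V \<Longrightarrow> finite (S u)"
  shows "coarse_median_group W"
proof -
  have "finite_generating_set W gens"
    using assms finite_vertices gens_sub gens_generate
    by (auto simp: finite_generating_set_def gens_def)
  then show ?thesis
    using coarse_median_median is_group
    unfolding coarse_median_group_def finitely_generated_group_def by blast
qed

end

section \<open>Graph products\<close>

locale graph_product_groups = pair_graph \<Gamma> for \<Gamma> :: "'v pair_pre_digraph" +
  fixes G :: "'v \<Rightarrow> ('g, 'm) monoid_scheme"
  assumes group_at: "u \<in> pverts \<Gamma> \<Longrightarrow> group (G u)"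
begin

abbreviation V where "V \<equiv> pverts \<Gamma>"
abbreviation F where "F \<equiv> free_product V G"
abbreviation N where "N \<equiv> normal_closure F (graph_product_relators \<Gamma> G)"

sublocale vertex_groups V "\<lambda>u v. (u, v) \<in> parcs \<Gamma>" G
  by (rule vertex_groups.intro) (use group_at no_loops' arcs_symmetric in blast)+

sublocale F: group F
  using free_product_group group_at by blast

lemma relators_closed: "graph_product_relators \<Gamma> G \<subseteq> carrier F"
  by (auto simp: graph_product_relators_def group_commutator_def fp_incl_def
      intro!: F.m_closed F.inv_closed free_product_carrierI
      dest: arc_fst_in_verts arc_snd_in_verts)

sublocale N: normal N F
  using normal_closure_normal relators_closed F.is_group by blast

lemma relators_in_N: "graph_product_relators \<Gamma> G \<subseteq> N"
  by (auto simp: normal_closure_def)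

lemma N_acts_trivially:
  assumes "X \<in> N"
  shows "acts_trivially X"
proof -
  have "graph_product_relators \<Gamma> G \<subseteq> {X \<in> carrier F. acts_trivially X}"
  proof
    fix X assume X: "X \<in> graph_product_relators \<Gamma> G"
    then obtain u v g h where uv: "(u, v) \<in> parcs \<Gamma>" "g \<in> carrier (G u)" "h \<in> carrier (G v)"
      and eq: "X = group_commutator F (fp_rel V G `` {[(u, g)]}) (fp_rel V G `` {[(v, h)]})"
      unfolding graph_product_relators_def fp_incl_def by blast
    have "u \<in> V" "v \<in> V" using arc_fst_in_verts[OF uv(1)] arc_snd_in_verts[OF uv(1)] by simp_all
    then have "acts_trivially X" unfolding eq using uv by (intro commutator_acts_trivially)
    then show "X \<in> {X \<in> carrier F. acts_trivially X}" using X relators_closed by blast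
  qed
  then show ?thesis using assms acts_trivially_normal unfolding normal_closure_def by blast
qed

section \<open>Normal forms of elements of the graph product\<close>

definition elt :: "('v \<times> 'g) list \<Rightarrow> ('v \<times> 'g) list set set"
  where "elt w = N #>\<^bsub>F\<^esub> (fp_rel V G `` {w})"

lemma elt_closed: "w \<in> fp_words V G \<Longrightarrow> elt w \<in> carrier (graph_product \<Gamma> G)"
  by (simp add: elt_def graph_product_def carrier_FactGroup free_product_carrierI)

lemma elt_exists:
  assumes "x \<in> carrier (graph_product \<Gamma> G)"
  obtains w where "w \<in> fp_words V G" "x = elt w"
  using assms by (auto simp: elt_def graph_product_def carrier_FactGroup elim!: free_product_carrierE)

lemma elt_append:
  "w \<in> fp_words V G \<Longrightarrow> w' \<in> fp_words V G \<Longrightarrow>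
    elt (w @ w') = elt w \<otimes>\<^bsub>graph_product \<Gamma> G\<^esub> elt w'"
  by (simp add: elt_def graph_product_def N.rcos_sum free_product_carrierI free_product_mult_class
      group_at)

lemma elt_Nil: "elt [] = \<one>\<^bsub>graph_product \<Gamma> G\<^esub>"
proof -
  have "fp_rel V G `` {[]} = \<one>\<^bsub>F\<^esub>" by (simp add: free_product_def)
  then show ?thesis
    by (simp add: elt_def graph_product_def F.coset_mult_one N.subset)
qed

lemma elt_cong: "(w, w') \<in> fp_rel V G \<Longrightarrow> elt w = elt w'"
  unfolding elt_def using equiv_class_eq[OF fp_rel_equiv] group_at by metis

text \<open>The normal form theorem: words for the same element differ in the free product by a
  factor from \<open>N\<close>, which acts trivially, so acting on the empty word gives the same
  normal word up to shuffling.\<close>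

lemma elt_eqD:
  assumes "w \<in> fp_words V G" "w' \<in> fp_words V G" "elt w = elt w'"
  shows "shuffle (word_act w []) (word_act w' [])"
proof -
  note mult = free_product_mult_class[of V G, OF group_at]
  have "fp_rel V G `` {w} \<in> N #>\<^bsub>F\<^esub> (fp_rel V G `` {w'})"
    using F.rcos_self[OF free_product_carrierI[OF assms(1)] N.is_subgroup] assms(3)
    by (simp add: elt_def)
  then obtain X where X: "X \<in> N" "fp_rel V G `` {w} = X \<otimes>\<^bsub>F\<^esub> (fp_rel V G `` {w'})"
    by (auto simp: r_coset_def)
  then have "X \<in> carrier F" using N.subset by blast
  then obtain z where z: "z \<in> fp_words V G" "X = fp_rel V G `` {z}"
    by (rule free_product_carrierE)
  have "(w, z @ w') \<in> fp_rel V G"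
    using X z assms mult by (intro cls_eqD) auto
  then have "shuffle (word_act w []) (word_act z (word_act w' []))"
    using fp_rel_word_act[of w "z @ w'" "[]"] by (simp add: word_act_append)
  moreover have "shuffle (word_act z (word_act w' [])) (word_act w' [])"
    using acts_triviallyD[of z "word_act w' []"] N_acts_trivially[OF X(1)] z
    by (simp add: normal_word_word_act[OF assms(2)])
  ultimately show ?thesis by (rule shuffle_trans)
qed

lemma elt_commute:
  assumes "(u, v) \<in> parcs \<Gamma>" "a \<in> carrier (G u)" "b \<in> carrier (G v)"
  shows "elt [(u, a), (v, b)] = elt [(v, b), (u, a)]"
proof -
  let ?a = "fp_rel V G `` {[(u, a)]}" and ?b = "fp_rel V G `` {[(v, b)]}"
  note mult = free_product_mult_class[of V G, OF group_at]
  have uv: "u \<in> V" "v \<in> V" using assms by (auto dest: arc_fst_in_verts arc_snd_in_verts)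
  have c: "?a \<in> carrier F" "?b \<in> carrier F"
    using uv assms by (auto intro: free_product_carrierI)
  have "group_commutator F ?a ?b \<in> N"
    using relators_in_N assms unfolding graph_product_relators_def fp_incl_def by blast
  \<comment> \<open>Written as a quotient of the two products, the relator fits the criterion for
    equality of cosets of \<open>N\<close>.\<close>
  moreover have "group_commutator F ?a ?b = (?a \<otimes>\<^bsub>F\<^esub> ?b) \<otimes>\<^bsub>F\<^esub> inv\<^bsub>F\<^esub> (?b \<otimes>\<^bsub>F\<^esub> ?a)"
    unfolding group_commutator_def F.inv_mult_group[OF c(2,1)] using c
    by (simp add: F.m_assoc)
  ultimately have "(?a \<otimes>\<^bsub>F\<^esub> ?b) \<otimes>\<^bsub>F\<^esub> inv\<^bsub>F\<^esub> (?b \<otimes>\<^bsub>F\<^esub> ?a) \<in> N" by metis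
  then have "?a \<otimes>\<^bsub>F\<^esub> ?b \<in> N #>\<^bsub>F\<^esub> (?b \<otimes>\<^bsub>F\<^esub> ?a)"
    by (rule N.rcos_module_rev[OF F.is_group F.m_closed[OF c(2,1)] F.m_closed[OF c]])
  then have coset: "N #>\<^bsub>F\<^esub> (?b \<otimes>\<^bsub>F\<^esub> ?a) = N #>\<^bsub>F\<^esub> (?a \<otimes>\<^bsub>F\<^esub> ?b)"
    by (rule F.repr_independence[OF _ F.m_closed[OF c(2,1)] N.is_subgroup])
  have ab: "?a \<otimes>\<^bsub>F\<^esub> ?b = fp_rel V G `` {[(u, a), (v, b)]}"
    using mult[of "[(u, a)]" "[(v, b)]"] uv assms by simp
  have ba: "?b \<otimes>\<^bsub>F\<^esub> ?a = fp_rel V G `` {[(v, b), (u, a)]}"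
    using mult[of "[(v, b)]" "[(u, a)]"] uv assms by simp
  show ?thesis unfolding elt_def by (rule coset[unfolded ab ba, symmetric])
qed

text \<open>Elements are cosets of classes of words, so a representative is chosen; by
  \<open>elt_eqD\<close> and \<open>head_shuffle\<close> every choice gives the same
  syllable.\<close>

definition head_of :: "'v \<Rightarrow> ('v \<times> 'g) list set set \<Rightarrow> 'g"
  where "head_of u x = head u (word_act (SOME w. w \<in> fp_words V G \<and> elt w = x) [])"

lemma head_of_elt:
  assumes "w \<in> fp_words V G"
  shows "head_of u (elt w) = head u (word_act w [])"
proof -
  let ?w = "SOME w'. w' \<in> fp_words V G \<and> elt w' = elt w"
  have "\<exists>w'. w' \<in> fp_words V G \<and> elt w' = elt w" using assms by blast
  from someI_ex[OF this] have "?w \<in> fp_words V G \<and> elt ?w = elt w" .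
  then show ?thesis
    unfolding head_of_def by (intro head_shuffle elt_eqD assms) simp_all
qed

sublocale head_projections "graph_product \<Gamma> G" V "\<lambda>u v. (u, v) \<in> parcs \<Gamma>" G
  "\<lambda>u a. elt [(u, a)]" head_of
proof (intro head_projections.intro head_projections_axioms.intro)
  let ?W = "graph_product \<Gamma> G"
  show "group ?W" using graph_product_group pair_graph_axioms group_at by blast
  show "vertex_groups V (\<lambda>u v. (u, v) \<in> parcs \<Gamma>) G" by (rule vertex_groups_axioms)
  have word: "normal_word (word_act w [])" if "w \<in> fp_words V G" for w
    using that normal_word_word_act by simp
  show "elt [(u, a)] \<in> carrier ?W" if "u \<in> V" "a \<in> carrier (G u)" for u a
    using that by (intro elt_closed) simp
  show "elt [(u, a \<otimes>\<^bsub>G u\<^esub> b)] = elt [(u, a)] \<otimes>\<^bsub>?W\<^esub> elt [(u, b)]"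
    if "u \<in> V" "a \<in> carrier (G u)" "b \<in> carrier (G u)" for u a b
    using that elt_cong[OF fp_rel.mult[of "[]" V G "[]" u a b]] elt_append[of "[(u, a)]" "[(u, b)]"]
    by simp
  show "elt [(u, a)] \<otimes>\<^bsub>?W\<^esub> elt [(v, b)] = elt [(v, b)] \<otimes>\<^bsub>?W\<^esub> elt [(u, a)]"
    if "u \<in> V" "v \<in> V" "(u, v) \<in> parcs \<Gamma>" "a \<in> carrier (G u)" "b \<in> carrier (G v)" for u v a b
    using that elt_commute[of u v a b] elt_append[of "[(u, a)]" "[(v, b)]"]
      elt_append[of "[(v, b)]" "[(u, a)]"] by simp
  show "\<exists>ws\<in>fp_words V G. foldr (\<lambda>(u, a). (\<otimes>\<^bsub>?W\<^esub>) (elt [(u, a)])) ws \<one>\<^bsub>?W\<^esub> = x"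
    if "x \<in> carrier ?W" for x
  proof -
    obtain w where w: "w \<in> fp_words V G" "x = elt w" using elt_exists \<open>x \<in> carrier ?W\<close> .
    have "w \<in> fp_words V G \<Longrightarrow> foldr (\<lambda>(u, a). (\<otimes>\<^bsub>?W\<^esub>) (elt [(u, a)])) w \<one>\<^bsub>?W\<^esub> = elt w" for w
    proof (induction w)
      case (Cons s w)
      then show ?case using elt_append[of "[s]" w] by (cases s) simp
    qed (simp add: elt_Nil)
    then show ?thesis using w by blast
  qed
  show "head_of u \<one>\<^bsub>?W\<^esub> = \<one>\<^bsub>G u\<^esub>" for u
    using head_of_elt[of "[]" u] by (simp add: elt_Nil)
  fix u x assume u: "u \<in> V" and "x \<in> carrier ?W"
  then obtain w where w: "w \<in> fp_words V G" "x = elt w" using elt_exists by blast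
  show "head_of u x \<in> carrier (G u)"
    using w u word by (simp add: head_of_elt head_closed)
  have cons: "head_of u (elt [(v, b)] \<otimes>\<^bsub>?W\<^esub> x) = head u (act v b (word_act w []))"
    if "v \<in> V" "b \<in> carrier (G v)" for v b
    using that w elt_append[of "[(v, b)]" w] head_of_elt[of "(v, b) # w" u] by simp
  show "head_of u (elt [(u, a)] \<otimes>\<^bsub>?W\<^esub> x) = a \<otimes>\<^bsub>G u\<^esub> head_of u x" if "a \<in> carrier (G u)" for a
    using cons[OF u that] head_act[OF u that word[OF w(1)]] w by (simp add: head_of_elt)
  fix v assume v: "v \<in> V"
  show "head_of u (elt [(v, b)] \<otimes>\<^bsub>?W\<^esub> x) = head_of u x"
    if "(u, v) \<in> parcs \<Gamma>" "b \<in> carrier (G v)" for b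
    using cons[OF v that(2)] head_act_adj[OF that(1)] w by (simp add: head_of_elt)
  show "head_of v x = \<one>\<^bsub>G v\<^esub>" if "u \<noteq> v" "(u, v) \<notin> parcs \<Gamma>" "head_of u x \<noteq> \<one>\<^bsub>G u\<^esub>"
    using that head_nonadj[of u v "word_act w []"] w by (simp add: head_of_elt)
qed

end

lemma coarse_median_group_strict:
  assumes "coarse_median_group H"
  obtains S \<kappa> \<nu> where "finite S" "word_metric H S"
    "strict_coarse_median (carrier H) (word_dist H S) \<kappa> \<nu>"
proof -
  obtain S \<mu> where S: "group H" "finite_generating_set H S"
    "coarse_median (carrier H) (word_dist H S) \<mu>"
    using assms unfolding coarse_median_group_def finitely_generated_group_def by blast
  then have "word_metric H S"
    by (auto simp: word_metric_def word_metric_axioms_def finite_generating_set_def)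
  then show thesis
    using that S word_metric.coarse_median_rectify unfolding finite_generating_set_def by metis
qed

theorem theorem8p9:
  fixes \<Gamma> :: "'v pair_pre_digraph"
    and G :: "'v \<Rightarrow> ('g, 'm) monoid_scheme"
  assumes "pair_graph \<Gamma>"
    and "\<And>u. u \<in> pverts \<Gamma> \<Longrightarrow> group (G u)"
    and "\<And>u. u \<in> pverts \<Gamma> \<Longrightarrow> carrier (G u) \<noteq> {\<one>\<^bsub>G u\<^esub>}"
    and "\<And>u. u \<in> pverts \<Gamma> \<Longrightarrow> finitely_generated_group (G u)"
    and "\<And>u. u \<in> pverts \<Gamma> \<Longrightarrow> coarse_median_group (G u)"
  shows "coarse_median_group (graph_product \<Gamma> G)"
proof -
  interpret graph_product_groups \<Gamma> G
    using assms(1,2) by (simp add: graph_product_groups_def graph_product_groups_axioms_def)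
  have fin: "finite V" using pair_finite_verts .
  \<comment> \<open>Generating set, constant and median are packed into one triple, so that a single
    choice provides all three.\<close>
  have "\<forall>u\<in>V. \<exists>t. finite (fst t) \<and> word_metric (G u) (fst t) \<and>
      strict_coarse_median (carrier (G u)) (word_dist (G u) (fst t)) (fst (snd t)) (snd (snd t))"
  proof
    fix u assume "u \<in> V"
    from assms(5)[OF this] obtain S \<kappa> \<nu> where "finite S" "word_metric (G u) S"
      "strict_coarse_median (carrier (G u)) (word_dist (G u) S) \<kappa> \<nu>"
      by (rule coarse_median_group_strict)
    then show "\<exists>t. finite (fst t) \<and> word_metric (G u) (fst t) \<and>
        strict_coarse_median (carrier (G u)) (word_dist (G u) (fst t)) (fst (snd t)) (snd (snd t))"
      by (intro exI[of _ "(S, \<kappa>, \<nu>)"]) simp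
  qed
  from bchoice[OF this] obtain t where t: "\<And>u. u \<in> V \<Longrightarrow> finite (fst (t u))"
    "\<And>u. u \<in> V \<Longrightarrow> word_metric (G u) (fst (t u))"
    "\<And>u. u \<in> V \<Longrightarrow> strict_coarse_median (carrier (G u)) (word_dist (G u) (fst (t u)))
      (fst (snd (t u))) (snd (snd (t u)))"
    by blast
  \<comment> \<open>A common constant for all vertices: a sum of non-negative terms dominates each
    of them, and it makes sense for the empty graph as well.\<close>
  define \<kappa> where "\<kappa> = (\<Sum>u\<in>V. fst (snd (t u)))"
  have nonneg: "0 \<le> fst (snd (t u))" if "u \<in> V" for u
    using t(3)[OF that] by (simp add: strict_coarse_median_def)
  interpret median_projections "graph_product \<Gamma> G" V "\<lambda>u v. (u, v) \<in> parcs \<Gamma>" G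
    "\<lambda>u a. elt [(u, a)]" head_of "\<lambda>u. fst (t u)" "\<lambda>u. snd (snd (t u))" \<kappa>
  proof (rule median_projections.intro[OF head_projections_axioms median_projections_axioms.intro])
    show "0 \<le> \<kappa>" unfolding \<kappa>_def using nonneg by (rule sum_nonneg)
    fix u assume u: "u \<in> V"
    have le: "fst (snd (t u)) \<le> \<kappa>"
      unfolding \<kappa>_def using u nonneg fin by (intro member_le_sum) auto
    show "strict_coarse_median (carrier (G u)) (word_dist (G u) (fst (t u))) \<kappa> (snd (snd (t u)))"
      by (rule strict_coarse_median_mono[OF t(3)[OF u] le word_metric.word_dist_nonneg[OF t(2)[OF u]]])
  qed (fact fin t(2))+
  show ?thesis using t(1) by (rule coarse_median_group_if_finite_gens)
qed

end
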